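(* If $\mathcal M\subset\mathcal F^2(\mathcal H_n)$ is a closed subspace that is invariant for each of $S_1,\dots,S_n$, then there exists a sequence $\{\varphi_j\}_{j\in J}$ of orthogonal inner functions such that $$\mathcal M=\bigoplus_{j\in J}\mathcal F^2(\mathcal H_n)\otimes\tilde\varphi_j .$$ Moreover, this representation is essentially unique.
   Context: Fix an integer $n\ge 1$ and $\Lambda=\{1,\dots,n\}$. Let $\mathcal F$ be the set of all finite words in $\Lambda$, i.e. functions $f:\{1,\dots,k\}\to\Lambda$, $k\ge 0$, the empty word being denoted $0$. The full Fock space $\mathcal F^2(\mathcal H_n)$ is the complex Hilbert space (norm $\|\cdot\|_2$) with orthonormal basis $\{e_f: f\in\mathcal F\}$, where $e_0=1$ and $e_f=e_{f(1)}\otimes\cdots\otimes e_{f(k)}$. The product $\otimes$ is the bilinear extension of concatenation of words: $\langle \varphi\otimes\psi,e_h\rangle=\sum_{e_f\otimes e_g=e_h}\langle\varphi,e_f\rangle\langle\psi,e_g\rangle$. $\mathcal P=\mathrm{span}\{e_f:f\in\mathcal F\}$. $F^\infty$ is the set of all $g\in\mathcal F^2(\mathcal H_n)$ with $\|g\|_\infty=\sup\{\|g\otimes p\|_2: p\in\mathcal P,\ \|p\|_2\le 1\}<\infty$. $S_i$ is the operator on $\mathcal F^2(\mathcal H_n)$ given by $S_i\psi=e_i\otimes\psi$. A function $\varphi\in F^\infty$ is inner if $h\mapsto\varphi\otimes h$ is an isometry on $\mathcal F^2(\mathcal H_n)$. Inner functions $\varphi_1,\varphi_2$ are orthogonal if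 $\varphi_1\otimes\mathcal F^2(\mathcal H_n)\perp\varphi_2\otimes\mathcal F^2(\mathcal H_n)$. The flip $\varphi\mapsto\tilde\varphi$ is the (linear) unitary operator on $\mathcal F^2(\mathcal H_n)$ with $e_f=e_{f(1)}\otimes\cdots\otimes e_{f(k)}\mapsto \tilde e_f=e_{f(k)}\otimes\cdots\otimes e_{f(1)}$. *)

theory Defs
  imports "HOL-Analysis.Analysis"
begin

section \<open>The full Fock space as a Hilbert space of square-summable families\<close>

text \<open>
  Words are lists over the alphabet \<open>'n\<close>; a vector is identified with its family of
  coefficients with respect to the orthonormal basis of words, i.e. the full Fock space is
  $\ell^2$ of the set of words. The library classes are real, so complex scalar multiplication
  and the complex inner product are provided separately.
\<close>

definition sq_summable :: "('n list \<Rightarrow> complex) \<Rightarrow> bool"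
  where "sq_summable a \<longleftrightarrow> (\<lambda>f. (cmod (a f))\<^sup>2) summable_on UNIV"

lemma sq_summable_0: "sq_summable (\<lambda>_. 0)"
  by (simp add: sq_summable_def)

lemma sq_summable_prod:
  assumes "sq_summable a" "sq_summable b"
  shows "(\<lambda>f. a f * cnj (b f)) summable_on UNIV"
proof -
  have "(\<lambda>f. norm (a f * cnj (b f))) summable_on UNIV"
    by (rule abs_summable_product)
      (use assms in \<open>simp_all add: sq_summable_def power2_eq_square norm_mult\<close>)
  then show ?thesis
    by (rule abs_summable_summable)
qed

lemma sq_summable_add:
  assumes "sq_summable a" "sq_summable b"
  shows "sq_summable (\<lambda>f. a f + b f)"
proof -
  have "(\<lambda>f. (cmod (a f))\<^sup>2 + (cmod (b f))\<^sup>2 + 2 * Re (a f * cnj (b f))) summable_on UNIV"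
    using assms sq_summable_prod[OF assms]
    by (intro summable_on_add summable_on_cmult_right summable_on_Re)
      (simp_all add: sq_summable_def)
  moreover have "(cmod (x + y))\<^sup>2 = (cmod x)\<^sup>2 + (cmod y)\<^sup>2 + 2 * Re (x * cnj y)" for x y
    unfolding cmod_power2 by (simp add: power2_eq_square algebra_simps)
  ultimately show ?thesis
    by (simp add: sq_summable_def)
qed

lemma sq_summable_scale: "sq_summable a \<Longrightarrow> sq_summable (\<lambda>f. c * a f)"
  by (simp add: sq_summable_def norm_mult power_mult_distrib summable_on_cmult_right)

lemma sq_summable_rev: "sq_summable (\<lambda>f. a (rev f)) \<longleftrightarrow> sq_summable a"
proof -
  have "bij_betw rev (UNIV :: 'a list set) UNIV"
    by (rule bij_betw_byWitness[where f' = rev]) auto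
  from summable_on_reindex_bij_betw[OF this, of "\<lambda>f. (cmod (a f))\<^sup>2"] show ?thesis
    by (simp add: sq_summable_def)
qed

lemma sq_summable_of_bool: "sq_summable (\<lambda>g. of_bool (g = f))"
  unfolding sq_summable_def
  by (rule finite_nonzero_values_imp_summable_on, rule finite_subset[of _ "{f}"]) auto

typedef 'n fock = "{a :: 'n list \<Rightarrow> complex. sq_summable a}"
  morphisms coeff Abs_fock
  using sq_summable_0 by blast

setup_lifting type_definition_fock

lemma sq_summable_coeff: "sq_summable (coeff \<phi>)"
  using coeff[of \<phi>] by simp

lemma fock_eqI: "(\<And>f. coeff \<phi> f = coeff \<psi> f) \<Longrightarrow> \<phi> = \<psi>"
  by (simp add: coeff_inject[symmetric] fun_eq_iff)

lift_definition scaleC_fock :: "complex \<Rightarrow> 'n fock \<Rightarrow> 'n fock"  (infixr "*\<^sub>C" 75)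
  is "\<lambda>c a f. c * a f"
  by (rule sq_summable_scale)

definition cinner :: "'n fock \<Rightarrow> 'n fock \<Rightarrow> complex"
  where "cinner \<phi> \<psi> = (\<Sum>\<^sub>\<infinity>f. coeff \<phi> f * cnj (coeff \<psi> f))"

instantiation fock :: (type) real_inner
begin

lift_definition zero_fock :: "'a fock" is "\<lambda>_. 0"
  by (rule sq_summable_0)

lift_definition plus_fock :: "'a fock \<Rightarrow> 'a fock \<Rightarrow> 'a fock" is "\<lambda>a b f. a f + b f"
  by (rule sq_summable_add)

lift_definition uminus_fock :: "'a fock \<Rightarrow> 'a fock" is "\<lambda>a f. - a f"
  by (simp add: sq_summable_def)

definition minus_fock :: "'a fock \<Rightarrow> 'a fock \<Rightarrow> 'a fock"
  where "minus_fock \<phi> \<psi> = \<phi> + (- \<psi>)"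

definition scaleR_fock :: "real \<Rightarrow> 'a fock \<Rightarrow> 'a fock"
  where "scaleR_fock r \<phi> = complex_of_real r *\<^sub>C \<phi>"

definition inner_fock :: "'a fock \<Rightarrow> 'a fock \<Rightarrow> real"
  where "inner_fock \<phi> \<psi> = Re (cinner \<phi> \<psi>)"

definition norm_fock :: "'a fock \<Rightarrow> real"
  where "norm_fock \<phi> = sqrt (\<Sum>\<^sub>\<infinity>f. (cmod (coeff \<phi> f))\<^sup>2)"

definition sgn_fock :: "'a fock \<Rightarrow> 'a fock"
  where "sgn_fock \<phi> = scaleR (inverse (norm \<phi>)) \<phi>"

definition dist_fock :: "'a fock \<Rightarrow> 'a fock \<Rightarrow> real"
  where "dist_fock \<phi> \<psi> = norm (\<phi> - \<psi>)"

definition uniformity_fock :: "('a fock \<times> 'a fock) filter"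
  where "uniformity_fock = (INF e\<in>{0 <..}. principal {(x, y). dist x y < e})"

definition open_fock :: "'a fock set \<Rightarrow> bool"
  where "open_fock U \<longleftrightarrow> (\<forall>x\<in>U. eventually (\<lambda>(x', y). x' = x \<longrightarrow> y \<in> U) uniformity)"

instance
proof
  fix x y z :: "'a fock" and r s :: real
  note fock_simps = zero_fock.rep_eq plus_fock.rep_eq uminus_fock.rep_eq scaleC_fock.rep_eq
  show "x + y + z = x + (y + z)" "x + y = y + x" "0 + x = x" "- x + x = 0"
    "r *\<^sub>R (x + y) = r *\<^sub>R x + r *\<^sub>R y" "(r + s) *\<^sub>R x = r *\<^sub>R x + s *\<^sub>R x"
    "r *\<^sub>R s *\<^sub>R x = (r * s) *\<^sub>R x" "1 *\<^sub>R x = x"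
    by (rule fock_eqI; simp add: fock_simps scaleR_fock_def algebra_simps)+
  show "x - y = x + - y" by (rule minus_fock_def)
  show "dist x y = norm (x - y)" by (rule dist_fock_def)
  show "sgn x = scaleR (inverse (norm x)) x" by (rule sgn_fock_def)
  show "uniformity = (INF e\<in>{0 <..}. principal {(x, y :: 'a fock). dist x y < e})"
    by (rule uniformity_fock_def)
  show "open U \<longleftrightarrow> (\<forall>x\<in>U. \<forall>\<^sub>F (x', y) in uniformity. x' = x \<longrightarrow> y \<in> U)" for U :: "'a fock set"
    by (rule open_fock_def)
  note summ = sq_summable_prod[OF sq_summable_coeff sq_summable_coeff]
  have cnj: "cinner y x = cnj (cinner x y)"
    by (simp add: cinner_def infsum_cnj[symmetric] mult.commute del: infsum_cnj)
  show "x \<bullet> y = y \<bullet> x"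
    by (simp add: inner_fock_def cnj)
  show "(x + y) \<bullet> z = x \<bullet> z + y \<bullet> z"
    by (simp add: inner_fock_def cinner_def fock_simps distrib_right infsum_add summ)
  show "r *\<^sub>R x \<bullet> y = r * (x \<bullet> y)"
    by (simp add: inner_fock_def cinner_def fock_simps scaleR_fock_def mult.assoc
        infsum_cmult_right')
  have sq: "x \<bullet> x = (\<Sum>\<^sub>\<infinity>f. (cmod (coeff x f))\<^sup>2)"
    unfolding inner_fock_def cinner_def
    by (subst infsum_Re[OF summ, symmetric])
      (simp add: complex_norm_square[symmetric] del: of_real_power)
  show "0 \<le> x \<bullet> x"
    unfolding sq by (rule infsum_nonneg) simp
  show "norm x = sqrt (x \<bullet> x)"
    by (simp add: sq norm_fock_def)
  show "x \<bullet> x = 0 \<longleftrightarrow> x = 0"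
  proof
    assume "x \<bullet> x = 0"
    then have "(cmod (coeff x f))\<^sup>2 = 0" for f
      using sq_summable_coeff[of x] unfolding sq sq_summable_def
      by (intro nonneg_infsum_le_0D[where A = UNIV]) auto
    then show "x = 0"
      by (intro fock_eqI) (simp add: fock_simps)
  qed (simp add: inner_fock_def cinner_def fock_simps)
qed

end

global_interpretation cfock: vector_space "scaleC_fock :: complex \<Rightarrow> 'n fock \<Rightarrow> 'n fock"
  by standard
    (rule fock_eqI; simp add: scaleC_fock.rep_eq plus_fock.rep_eq algebra_simps)+


section \<open>Products, the algebra \<open>F\<^sup>\<infinity>\<close> and inner functions\<close>

lift_definition word_vec :: "'n list \<Rightarrow> 'n fock" is "\<lambda>f g. of_bool (g = f)"
  by (rule sq_summable_of_bool)

definition cauchy_product :: "('n list \<Rightarrow> complex) \<Rightarrow> ('n list \<Rightarrow> complex) \<Rightarrow> 'n list \<Rightarrow> complex"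
  where "cauchy_product a b h = (\<Sum>(f, g) \<in> {(f, g). f @ g = h}. a f * b g)"

text \<open>
  The product of two vectors of the Fock space need not lie in the Fock space; the operation is
  made total by the value \<open>0\<close> in that case. No such case occurs if one factor is a
  polynomial.
\<close>

lift_definition tensor :: "'n fock \<Rightarrow> 'n fock \<Rightarrow> 'n fock"  (infixl "\<otimes>\<^sub>F" 70)
  is "\<lambda>a b. if sq_summable (cauchy_product a b) then cauchy_product a b else (\<lambda>_. 0)"
  by (simp add: sq_summable_0)

definition polynomials :: "'n fock set"
  where "polynomials = cfock.span (range word_vec)"

definition norm_inf :: "'n fock \<Rightarrow> ennreal"
  where "norm_inf g = (SUP p \<in> {p \<in> polynomials. norm p \<le> 1}. ennreal (norm (g \<otimes>\<^sub>F p)))"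

definition F_infinity :: "'n fock set"
  where "F_infinity = {g. norm_inf g < \<infinity>}"

definition left_creation :: "'n \<Rightarrow> 'n fock \<Rightarrow> 'n fock"
  where "left_creation i \<psi> = word_vec [i] \<otimes>\<^sub>F \<psi>"

lift_definition flip :: "'n fock \<Rightarrow> 'n fock" is "\<lambda>a f. a (rev f)"
  by (simp add: sq_summable_rev)

lemma flip_word_vec: "flip (word_vec f) = word_vec (rev f)"
  by (rule fock_eqI) (auto simp: flip.rep_eq word_vec.rep_eq)

text \<open>
  In the next definition, totality of the product does no harm: the norm identity fails for
  \<open>h \<noteq> 0\<close> whenever the product is not square-summable.
\<close>

definition inner_function :: "'n fock \<Rightarrow> bool"
  where "inner_function \<phi> \<longleftrightarrow> \<phi> \<in> F_infinity \<and> (\<forall>h. norm (\<phi> \<otimes>\<^sub>F h) = norm h)"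

definition orthogonal_sets :: "'n fock set \<Rightarrow> 'n fock set \<Rightarrow> bool"
  where "orthogonal_sets A B \<longleftrightarrow> (\<forall>x\<in>A. \<forall>y\<in>B. cinner x y = 0)"

definition orthogonal_inner_functions :: "'j set \<Rightarrow> ('j \<Rightarrow> 'n fock) \<Rightarrow> bool"
  where "orthogonal_inner_functions J \<phi> \<longleftrightarrow>
    (\<forall>j\<in>J. inner_function (\<phi> j)) \<and>
    (\<forall>i\<in>J. \<forall>j\<in>J. i \<noteq> j \<longrightarrow>
      orthogonal_sets (range (\<lambda>h. \<phi> i \<otimes>\<^sub>F h)) (range (\<lambda>h. \<phi> j \<otimes>\<^sub>F h)))"


section \<open>Orthogonal decompositions\<close>

definition closed_csubspace :: "'n fock set \<Rightarrow> bool"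
  where "closed_csubspace M \<longleftrightarrow> cfock.subspace M \<and> closed M"

definition is_hilbert_sum :: "'n fock set \<Rightarrow> 'j set \<Rightarrow> ('j \<Rightarrow> 'n fock set) \<Rightarrow> bool"
  where "is_hilbert_sum M J N \<longleftrightarrow>
    (\<forall>j\<in>J. closed_csubspace (N j)) \<and>
    (\<forall>i\<in>J. \<forall>j\<in>J. i \<noteq> j \<longrightarrow> orthogonal_sets (N i) (N j)) \<and>
    M = closure (cfock.span (\<Union>j\<in>J. N j))"

definition represents :: "'j set \<Rightarrow> ('j \<Rightarrow> 'n fock) \<Rightarrow> 'n fock set \<Rightarrow> bool"
  where "represents J \<phi> M \<longleftrightarrow>
    orthogonal_inner_functions J \<phi> \<and>
    is_hilbert_sum M J (\<lambda>j. range (\<lambda>\<psi>. \<psi> \<otimes>\<^sub>F flip (\<phi> j)))"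

text \<open>
  A matrix with rows indexed by \<open>K\<close> and columns indexed by \<open>J\<close> is unitary if both its rows and
  its columns are orthonormal; it is then the matrix of a unitary operator from $\ell^2(J)$
  onto $\ell^2(K)$, so that in particular \<open>J\<close> and \<open>K\<close> have the same cardinality.
\<close>

definition unitary_matrix :: "'k set \<Rightarrow> 'j set \<Rightarrow> ('k \<Rightarrow> 'j \<Rightarrow> complex) \<Rightarrow> bool"
  where "unitary_matrix K J u \<longleftrightarrow>
    (\<forall>k\<in>K. \<forall>l\<in>K. ((\<lambda>j. u k j * cnj (u l j)) has_sum of_bool (k = l)) J) \<and>
    (\<forall>i\<in>J. \<forall>j\<in>J. ((\<lambda>k. u k i * cnj (u k j)) has_sum of_bool (i = j)) K)"

text \<open>
  Two representations of one subspace are essentially the same if the two sequences are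
  related by a unitary matrix of scalars.
\<close>

definition essentially_equal ::
    "'j set \<Rightarrow> ('j \<Rightarrow> 'n fock) \<Rightarrow> 'k set \<Rightarrow> ('k \<Rightarrow> 'n fock) \<Rightarrow> bool"
  where "essentially_equal J \<phi> K \<psi> \<longleftrightarrow>
    (\<exists>u. unitary_matrix K J u \<and>
      (\<forall>k\<in>K. ((\<lambda>j. u k j *\<^sub>C \<phi> j) has_sum \<psi> k) J))"

end

theory Submission
  imports Defs
begin

text \<open>
  The theorem is the Wold decomposition for the row of creation operators
  \<open>S\<^sub>i = left_creation i\<close>, which are isometries with pairwise orthogonal ranges. Given an
  invariant closed subspace \<open>M\<close>, let \<open>L\<close> be its wandering subspace, the orthogonal complement
  in \<open>M\<close> of the sum of the \<open>S\<^sub>i M\<close>. Then the translates \<open>e\<^sub>f \<otimes> L\<close> over all words \<open>f\<close> are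
  pairwise orthogonal: after a common prefix is cancelled, one factor lies in \<open>L\<close> and the other
  in some \<open>S\<^sub>i M\<close> (\<open>wandering_translates_orthogonal\<close>). They also fill \<open>M\<close>: a vector \<open>x\<close> of \<open>M\<close>
  orthogonal to \<open>L\<close> is a sum of \<open>S\<^sub>i x\<^sub>i\<close> with \<open>x\<^sub>i\<close> in \<open>M\<close>
  (\<open>orthogonal_wandering_imp_shifted\<close>), and if it is orthogonal to all translates, then so are
  the \<open>x\<^sub>i\<close>; iterating, the coefficients of \<open>x\<close> at words of every length vanish
  (\<open>zero_if_orthogonal_translates\<close>).

  Now let \<open>v\<close> be an orthonormal basis of \<open>L\<close>, countable because there are countably many words.
  The vectors \<open>e\<^sub>f \<otimes> v\<^sub>j\<close> are orthonormal, and this is what makes \<open>h \<mapsto> h \<otimes> v\<^sub>j\<close> an everywhere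
  defined isometry (\<open>multiplier_if_orthonormal\<close>). The flip reverses products, so that these
  isometries correspond to inner functions (\<open>inner_function_iff\<close>): the \<open>flip v\<^sub>j\<close> are
  orthogonal inner functions, and \<open>M\<close> is the orthogonal sum of the ranges of the right
  multiplications (\<open>wandering_basis_represents\<close>).

  Conversely, if inner functions \<open>\<phi>\<^sub>j\<close> represent \<open>M\<close>, the recursion
  \<open>h \<otimes> v = h(0) v + \<Sum>\<^sub>i S\<^sub>i (S\<^sub>i\<^sup>* h \<otimes> v)\<close> shows that the vectors \<open>flip \<phi>\<^sub>j\<close> form an
  orthonormal basis of \<open>L\<close> (\<open>represents_imp_wandering_basis\<close>). As \<open>L\<close> depends on \<open>M\<close> only, two
  representations come from two orthonormal bases of one Hilbert space, and the matrix of their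
  inner products is unitary (\<open>essentially_equal_if_same_closed_span\<close>).

  The Hilbert space facts behind this are completeness of the Fock space, orthogonal projection
  onto closed subspaces, and expansion in orthonormal families.
\<close>

section \<open>Complex Hilbert space structure of the Fock space\<close>

lemmas fock_coeff_simps [simp] =
  zero_fock.rep_eq plus_fock.rep_eq uminus_fock.rep_eq scaleC_fock.rep_eq word_vec.rep_eq
  flip.rep_eq

lemma coeff_minus [simp]: "coeff (x - y) f = coeff x f - coeff y f"
  by (simp only: minus_fock_def fock_coeff_simps) simp

lemma coeff_scaleR [simp]: "coeff (r *\<^sub>R x) f = of_real r * coeff x f"
  by (simp add: scaleR_fock_def)

lemma coeff_sum [simp]: "coeff (sum x A) f = (\<Sum>i\<in>A. coeff (x i) f)"
  by (induction A rule: infinite_finite_induct) auto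

lemma cinner_summable: "(\<lambda>f. coeff x f * cnj (coeff y f)) summable_on UNIV"
  by (rule sq_summable_prod[OF sq_summable_coeff sq_summable_coeff])

lemma cnj_cinner: "cnj (cinner x y) = cinner y x"
  by (simp add: cinner_def infsum_cnj[symmetric] mult.commute del: infsum_cnj)

lemma cinner_add_left: "cinner (x + y) z = cinner x z + cinner y z"
  by (simp add: cinner_def distrib_right infsum_add cinner_summable)

lemma cinner_scaleC_left: "cinner (c *\<^sub>C x) y = c * cinner x y"
  by (simp add: cinner_def mult.assoc infsum_cmult_right')

lemma cinner_add_right: "cinner x (y + z) = cinner x y + cinner x z"
  by (subst (1 2 3) cnj_cinner[symmetric]) (simp add: cinner_add_left)

lemma cinner_scaleC_right: "cinner x (c *\<^sub>C y) = cnj c * cinner x y"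
  by (subst (1 2) cnj_cinner[symmetric]) (simp add: cinner_scaleC_left)

text \<open>
  Through this formula the complex inner product inherits continuity from the real one.
\<close>

lemma cinner_eq_inner: "cinner x y = of_real (x \<bullet> y) + \<i> * of_real (((- \<i>) *\<^sub>C x) \<bullet> y)"
  unfolding inner_fock_def cinner_scaleC_left by (simp add: complex_eq_iff)

lemma bounded_linear_cinner_right: "bounded_linear (\<lambda>y. cinner x y)"
  unfolding cinner_eq_inner
  by (intro bounded_linear_add bounded_linear_const_mult
      bounded_linear_compose[OF bounded_linear_of_real] bounded_linear_inner_right)

lemma bounded_linear_cinner_left: "bounded_linear (\<lambda>x. cinner x y)"
  using bounded_linear_compose[OF bounded_linear_cnj bounded_linear_cinner_right[of y]]
  by (simp add: cnj_cinner)

lemmas cinner_right_simps =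
  linear_0[OF bounded_linear.linear[OF bounded_linear_cinner_right]]
  linear_diff[OF bounded_linear.linear[OF bounded_linear_cinner_right]]
  linear_sum[OF bounded_linear.linear[OF bounded_linear_cinner_right]]
  linear_neg[OF bounded_linear.linear[OF bounded_linear_cinner_right]]
lemmas cinner_left_simps =
  linear_0[OF bounded_linear.linear[OF bounded_linear_cinner_left]]
  linear_diff[OF bounded_linear.linear[OF bounded_linear_cinner_left]]
  linear_sum[OF bounded_linear.linear[OF bounded_linear_cinner_left]]
  linear_neg[OF bounded_linear.linear[OF bounded_linear_cinner_left]]
lemmas cinner_simps = cinner_right_simps cinner_left_simps
  cinner_add_left cinner_add_right cinner_scaleC_left cinner_scaleC_right

lemma cinner_self: "cinner x x = of_real ((norm x)\<^sup>2)"
proof -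
  have "Im (cinner x x) = 0"
    using cnj_cinner[of x x] by (simp add: complex_eq_iff)
  moreover have "Re (cinner x x) = (norm x)\<^sup>2"
    by (simp add: inner_fock_def[symmetric] power2_norm_eq_inner)
  ultimately show ?thesis
    by (simp add: complex_eq_iff)
qed

lemma cinner_self_eq_0 [simp]: "cinner x x = 0 \<longleftrightarrow> x = 0"
  by (simp add: cinner_self)

lemma cinner_commute_eq_0: "cinner x y = 0 \<longleftrightarrow> cinner y x = 0"
  by (metis cnj_cinner complex_cnj_zero)

lemma norm_eq_1_iff_cinner: "norm x = 1 \<longleftrightarrow> cinner x x = 1"
proof -
  have "cinner x x = 1 \<longleftrightarrow> (norm x)\<^sup>2 = 1"
    unfolding cinner_self by (metis of_real_1 of_real_eq_iff)
  then show ?thesis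
    by (simp add: power2_eq_1_iff) (use norm_ge_zero[of x] in linarith)
qed

lemma power2_norm_fock: "(norm x)\<^sup>2 = (\<Sum>\<^sub>\<infinity>f. (cmod (coeff x f))\<^sup>2)"
  by (simp add: norm_fock_def infsum_nonneg)

lemma norm_scaleC: "norm (c *\<^sub>C x) = cmod c * norm x"
proof -
  have "cinner (c *\<^sub>C x) (c *\<^sub>C x) = (c * cnj c) * cinner x x"
    by (simp add: cinner_simps)
  also have "\<dots> = of_real ((cmod c * norm x)\<^sup>2)"
    by (simp only: cinner_self complex_norm_square[symmetric] of_real_mult power_mult_distrib)
  finally have "cinner (c *\<^sub>C x) (c *\<^sub>C x) = of_real ((cmod c * norm x)\<^sup>2)" .
  then have "(norm (c *\<^sub>C x))\<^sup>2 = (cmod c * norm x)\<^sup>2"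
    unfolding cinner_self of_real_eq_iff .
  then show ?thesis
    by simp
qed

lemma bounded_linear_scaleC: "bounded_linear (\<lambda>x. c *\<^sub>C x)"
proof (rule bounded_linear_intro[where K = "cmod c"])
  show "c *\<^sub>C (r *\<^sub>R x) = r *\<^sub>R (c *\<^sub>C x)" for r x
    by (rule fock_eqI) simp
qed (simp_all add: cfock.scale_right_distrib norm_scaleC mult.commute)

lemma cinner_word_vec: "cinner x (word_vec f) = coeff x f"
proof -
  have "cinner x (word_vec f) = (\<Sum>\<^sub>\<infinity>g\<in>{f}. coeff x g)"
    unfolding cinner_def by (rule infsum_cong_neutral) auto
  then show ?thesis
    by simp
qed

lemma norm_word_vec [simp]: "norm (word_vec f) = 1"
  unfolding norm_eq_1_iff_cinner by (simp add: cinner_word_vec)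

lemma bounded_linear_coeff: "bounded_linear (\<lambda>x. coeff x f)"
  using bounded_linear_cinner_left[of "word_vec f"] by (simp add: cinner_word_vec)

text \<open>
  Both completeness and the boundedness of multiplication operators are obtained from bounds that
  are uniform over finite sets of words, because such sums pass to coefficientwise limits.
\<close>

lemma sq_summable_bounded:
  assumes "\<And>F. finite F \<Longrightarrow> (\<Sum>f\<in>F. (cmod (a f))\<^sup>2) \<le> B"
  shows "sq_summable a" and "(\<Sum>\<^sub>\<infinity>f. (cmod (a f))\<^sup>2) \<le> B"
proof -
  show *: "sq_summable a"
    unfolding sq_summable_def
    by (rule nonneg_bdd_above_summable_on) (auto intro!: bdd_aboveI[where M = B] assms)
  show "(\<Sum>\<^sub>\<infinity>f. (cmod (a f))\<^sup>2) \<le> B"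
    using * by (intro infsum_le_finite_sums) (auto simp: sq_summable_def assms)
qed

lemma sum_sq_coeff_le: "finite F \<Longrightarrow> (\<Sum>f\<in>F. (cmod (coeff x f))\<^sup>2) \<le> (norm x)\<^sup>2"
  unfolding power2_norm_fock
  by (rule finite_sum_le_infsum) (use sq_summable_coeff[of x] in \<open>auto simp: sq_summable_def\<close>)

text \<open>
  Coefficients of a Cauchy sequence converge; the Cauchy estimate, restricted to a finite set of
  words, survives the limit and so controls the whole tail.
\<close>

instance fock :: (type) banach
proof
  fix X :: "nat \<Rightarrow> 'a fock"
  assume X: "Cauchy X"
  have "Cauchy (\<lambda>n. coeff (X n) f)" for f
    by (rule bounded_linear.Cauchy[OF bounded_linear_coeff X])
  then have "\<exists>l. (\<lambda>n. coeff (X n) f) \<longlonglongrightarrow> l" for f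
    by (simp add: Cauchy_convergent_iff convergent_def)
  then obtain a where a: "\<And>f. (\<lambda>n. coeff (X n) f) \<longlonglongrightarrow> a f"
    by metis
  have tail: "(\<Sum>f\<in>F. (cmod (coeff (X m) f - a f))\<^sup>2) \<le> e\<^sup>2"
    if N: "\<forall>m\<ge>N. \<forall>n\<ge>N. dist (X m) (X n) < e" and m: "m \<ge> N" and F: "finite F" for F N m e
  proof (rule Lim_bounded)
    show "(\<lambda>n. \<Sum>f\<in>F. (cmod (coeff (X m) f - coeff (X n) f))\<^sup>2)
        \<longlonglongrightarrow> (\<Sum>f\<in>F. (cmod (coeff (X m) f - a f))\<^sup>2)"
      by (intro tendsto_intros a)
    show "\<forall>n\<ge>N. (\<Sum>f\<in>F. (cmod (coeff (X m) f - coeff (X n) f))\<^sup>2) \<le> e\<^sup>2"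
    proof (intro allI impI)
      fix n assume "n \<ge> N"
      then have "(norm (X m - X n))\<^sup>2 \<le> e\<^sup>2"
        using N m by (intro power_mono) (auto simp: dist_norm intro: less_imp_le)
      then show "(\<Sum>f\<in>F. (cmod (coeff (X m) f - coeff (X n) f))\<^sup>2) \<le> e\<^sup>2"
        using sum_sq_coeff_le[OF F, of "X m - X n"] by simp
    qed
  qed
  obtain N where N: "\<forall>m\<ge>N. \<forall>n\<ge>N. dist (X m) (X n) < 1"
    using X unfolding Cauchy_def by (meson zero_less_one)
  have "sq_summable (\<lambda>f. coeff (X N) f + (- 1) * (coeff (X N) f - a f))"
    by (intro sq_summable_add sq_summable_coeff sq_summable_scale
        sq_summable_bounded(1)[where B = "1\<^sup>2"] tail[OF N]) simp_all
  then have "sq_summable a"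
    by simp
  then obtain x where x: "\<And>f. coeff x f = a f"
    by (metis Abs_fock_inverse mem_Collect_eq)
  have "X \<longlonglongrightarrow> x"
    unfolding LIMSEQ_def
  proof (intro allI impI)
    fix r :: real assume "r > 0"
    then obtain N where N: "\<forall>m\<ge>N. \<forall>n\<ge>N. dist (X m) (X n) < r / 2"
      using X unfolding Cauchy_def by (meson half_gt_zero)
    have "dist (X m) x < r" if "m \<ge> N" for m
    proof -
      have "(norm (X m - x))\<^sup>2 \<le> (r / 2)\<^sup>2"
        unfolding power2_norm_fock
        by (rule sq_summable_bounded(2)) (simp add: x tail[OF N that])
      then have "norm (X m - x) \<le> r / 2"
        by (rule power2_le_imp_le) (use \<open>r > 0\<close> in simp)
      with \<open>r > 0\<close> show ?thesis
        by (simp add: dist_norm)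
    qed
    then show "\<exists>no. \<forall>n\<ge>no. dist (X n) x < r"
      by blast
  qed
  then show "convergent X"
    by (rule convergentI)
qed

section \<open>Orthogonal projection\<close>

text \<open>
  By the parallelogram law, two almost nearest points of a subspace are close to each other:
  otherwise their midpoint would be nearer than the distance allows.
\<close>

lemma minimizing_sequence_Cauchy:
  fixes X :: "nat \<Rightarrow> 'a::real_inner"
  assumes S: "subspace S" and X: "\<And>n. X n \<in> S"
    and d: "\<And>y. y \<in> S \<Longrightarrow> d \<le> (norm (x - y))\<^sup>2"
    and lim: "\<And>n. (norm (x - X n))\<^sup>2 < d + inverse (Suc n)"
  shows "Cauchy X"
proof (rule CauchyI)
  fix e :: real assume "e > 0"
  then obtain N where N: "inverse (Suc N) < e\<^sup>2 / 4"
    using reals_Archimedean[of "e\<^sup>2 / 4"] by auto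
  have "norm (X m - X n) < e" if "m \<ge> N" "n \<ge> N" for m n
  proof -
    have le: "inverse (real (Suc k)) \<le> inverse (Suc N)" if "k \<ge> N" for k
      using that by (intro le_imp_inverse_le) auto
    have mid: "(1/2) *\<^sub>R (X m + X n) \<in> S"
      by (intro subspace_scale subspace_add S X)
    have "(norm (X m - X n))\<^sup>2 =
        2 * (norm (x - X m))\<^sup>2 + 2 * (norm (x - X n))\<^sup>2 - 4 * (norm (x - (1/2) *\<^sub>R (X m + X n)))\<^sup>2"
      unfolding power2_norm_eq_inner
      by (simp add: inner_diff_left inner_diff_right inner_add_left inner_add_right inner_commute
          algebra_simps)
    also have "\<dots> < 4 * inverse (Suc N)"
      using d[OF mid] lim[of m] lim[of n] le[OF that(1)] le[OF that(2)] by linarith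
    also have "\<dots> < e\<^sup>2"
      using N by simp
    finally show ?thesis
      using \<open>e > 0\<close> by (simp add: power_less_imp_less_base)
  qed
  then show "\<exists>N. \<forall>m\<ge>N. \<forall>n\<ge>N. norm (X m - X n) < e"
    by blast
qed

text \<open>
  The projection is the nearest point of the subspace, obtained as limit of a minimizing
  sequence. Moving from it in a direction \<open>y\<close> of the subspace cannot decrease the distance, which
  forces the error to be orthogonal to \<open>y\<close>.
\<close>

lemma orthogonal_projection_exists:
  fixes S :: "'a::{real_inner, complete_space} set"
  assumes S: "subspace S" and "closed S"
  obtains p where "p \<in> S" and "\<And>y. y \<in> S \<Longrightarrow> (x - p) \<bullet> y = 0"
proof -
  define D where "D = (\<lambda>y. (norm (x - y))\<^sup>2) ` S"
  define d where "d = Inf D"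
  have bdd: "bdd_below D"
    by (auto simp: D_def intro!: bdd_belowI[where m = 0])
  have ne: "D \<noteq> {}"
    using subspace_0[OF S] by (auto simp: D_def)
  have d: "d \<le> (norm (x - y))\<^sup>2" if "y \<in> S" for y
    unfolding d_def by (rule cInf_lower[OF _ bdd]) (use that in \<open>auto simp: D_def\<close>)
  have "\<exists>y\<in>S. (norm (x - y))\<^sup>2 < d + inverse (Suc n)" for n
  proof -
    have "Inf D < d + inverse (Suc n)"
      by (simp add: d_def)
    then show ?thesis
      using cInf_less_iff[OF ne bdd] by (auto simp: D_def)
  qed
  then obtain X where X: "\<And>n. X n \<in> S" "\<And>n. (norm (x - X n))\<^sup>2 < d + inverse (Suc n)"
    by metis
  then have "Cauchy X"
    using d by (intro minimizing_sequence_Cauchy[OF S]) auto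
  then obtain p where p: "X \<longlonglongrightarrow> p"
    by (auto simp: Cauchy_convergent_iff convergent_def)
  have "p \<in> S"
    using closed_sequentially[OF \<open>closed S\<close> _ p] X(1) by blast
  have pd: "(norm (x - p))\<^sup>2 \<le> d"
  proof (rule LIMSEQ_le)
    show "(\<lambda>n. (norm (x - X n))\<^sup>2) \<longlonglongrightarrow> (norm (x - p))\<^sup>2"
      by (intro tendsto_intros p)
    show "(\<lambda>n. d + inverse (Suc n)) \<longlonglongrightarrow> d"
      using LIMSEQ_inverse_real_of_nat_add by simp
    show "\<exists>N. \<forall>n\<ge>N. (norm (x - X n))\<^sup>2 \<le> d + inverse (Suc n)"
      using X(2) less_imp_le by blast
  qed
  have "(x - p) \<bullet> y = 0" if "y \<in> S" for y
  proof (cases "y = 0")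
    case False
    \<comment> \<open>the step length that minimizes the distance along \<open>y\<close>\<close>
    define t where "t = ((x - p) \<bullet> y) / (y \<bullet> y)"
    have yy: "y \<bullet> y > 0"
      using False by simp
    have "(norm (x - p))\<^sup>2 \<le> (norm (x - (p + t *\<^sub>R y)))\<^sup>2"
      using pd d[of "p + t *\<^sub>R y"] S \<open>p \<in> S\<close> that
      by (meson order_trans subspace_add subspace_scale)
    also have "\<dots> = (norm ((x - p) - t *\<^sub>R y))\<^sup>2"
      by (simp add: algebra_simps)
    also have "\<dots> = (norm (x - p))\<^sup>2 - 2 * t * ((x - p) \<bullet> y) + t * t * (y \<bullet> y)"
      unfolding power2_norm_eq_inner
      by (simp add: inner_diff_left[of "x - p"] inner_diff_right[of _ "x - p"] inner_commute)
    also have "t * t * (y \<bullet> y) = t * ((x - p) \<bullet> y)"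
      using yy by (simp add: t_def)
    finally have "t * ((x - p) \<bullet> y) \<le> 0"
      by simp
    then have "((x - p) \<bullet> y)\<^sup>2 \<le> 0"
      using yy by (simp add: t_def power2_eq_square divide_le_0_iff)
    then show ?thesis
      by simp
  qed simp
  with \<open>p \<in> S\<close> show thesis
    by (rule that)
qed

lemma csubspace_imp_subspace: "cfock.subspace S \<Longrightarrow> subspace S"
  unfolding subspace_def cfock.subspace_def scaleR_fock_def by blast

text \<open>
  Real orthogonality to both \<open>y\<close> and \<open>\<i> y\<close> is complex orthogonality to \<open>y\<close>, so the
  real projection already serves a complex subspace.
\<close>

lemma orthogonal_projection_exists_complex:
  assumes S: "closed_csubspace S"
  obtains p where "p \<in> S" and "\<And>y. y \<in> S \<Longrightarrow> cinner (x - p) y = 0"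
proof -
  obtain p where p: "p \<in> S" "\<And>y. y \<in> S \<Longrightarrow> (x - p) \<bullet> y = 0"
    using orthogonal_projection_exists[of S x] S csubspace_imp_subspace
    by (auto simp: closed_csubspace_def)
  have "cinner (x - p) y = 0" if "y \<in> S" for y
  proof -
    have "\<i> *\<^sub>C y \<in> S"
      using S that by (simp add: closed_csubspace_def cfock.subspace_scale)
    then have "Re (cinner (x - p) y) = 0" "Re (cinner (x - p) (\<i> *\<^sub>C y)) = 0"
      using p(2) that by (simp_all add: inner_fock_def)
    then show ?thesis
      by (simp add: cinner_scaleC_right complex_eq_iff)
  qed
  with p(1) show thesis
    by (rule that)
qed

lemma csubspace_closure:
  assumes S: "cfock.subspace S"
  shows "cfock.subspace (closure S)"
proof (rule cfock.subspaceI)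
  show "0 \<in> closure S"
    by (rule subsetD[OF closure_subset cfock.subspace_0[OF S]])
  show "x + y \<in> closure S" if xy: "x \<in> closure S" "y \<in> closure S" for x y
  proof -
    obtain X Y where XY: "\<And>n. X n \<in> S" "X \<longlonglongrightarrow> x" "\<And>n. Y n \<in> S" "Y \<longlonglongrightarrow> y"
      using xy unfolding closure_sequential by blast
    have "X n + Y n \<in> S" for n
      by (rule cfock.subspace_add[OF S XY(1,3)])
    then show ?thesis
      using tendsto_add[OF XY(2,4)] unfolding closure_sequential
      by (intro exI[of _ "\<lambda>n. X n + Y n"]) simp
  qed
  show "c *\<^sub>C x \<in> closure S" if "x \<in> closure S" for c x
  proof -
    have "(\<lambda>x. c *\<^sub>C x) ` closure S \<subseteq> closure ((\<lambda>x. c *\<^sub>C x) ` S)"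
      by (rule closure_bounded_linear_image_subset[OF bounded_linear_scaleC])
    also have "\<dots> \<subseteq> closure S"
      by (rule closure_mono) (auto intro: cfock.subspace_scale[OF S])
    finally show ?thesis
      using that by blast
  qed
qed

lemma closed_csubspace_closure_span: "closed_csubspace (closure (cfock.span U))"
  by (simp add: closed_csubspace_def csubspace_closure)

lemma closure_span_superset: "U \<subseteq> closure (cfock.span U)"
  using cfock.span_superset closure_subset by blast

lemma closure_span_minimal:
  "U \<subseteq> S \<Longrightarrow> closed_csubspace S \<Longrightarrow> closure (cfock.span U) \<subseteq> S"
  unfolding closed_csubspace_def by (rule closure_minimal[OF cfock.span_minimal]) simp_all

lemma closed_csubspace_annihilator: "closed_csubspace {x. \<forall>u\<in>U. cinner x u = 0}"
proof -
  have "closed (\<Inter>u\<in>U. (\<lambda>x. cinner x u) -` {0})"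
    by (intro closed_INT ballI closed_vimage closed_singleton
        linear_continuous_on[OF bounded_linear_cinner_left])
  moreover have "(\<Inter>u\<in>U. (\<lambda>x. cinner x u) -` {0}) = {x. \<forall>u\<in>U. cinner x u = 0}"
    by auto
  ultimately show ?thesis
    by (simp add: closed_csubspace_def cfock.subspace_def cinner_simps)
qed

lemma closed_csubspace_Int:
  "closed_csubspace A \<Longrightarrow> closed_csubspace B \<Longrightarrow> closed_csubspace (A \<inter> B)"
  by (simp add: closed_csubspace_def cfock.subspace_inter closed_Int)

lemma orthogonal_closure_span:
  assumes "\<And>u. u \<in> U \<Longrightarrow> cinner u x = 0" and y: "y \<in> closure (cfock.span U)"
  shows "cinner y x = 0"
proof -
  have "closure (cfock.span U) \<subseteq> {y. \<forall>u\<in>{x}. cinner y u = 0}"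
    by (rule closure_span_minimal[OF _ closed_csubspace_annihilator]) (use assms(1) in auto)
  with y show ?thesis
    by auto
qed

text \<open>
  Every density statement below (for the words, for bases of the wandering subspace, for
  the summands of an invariant subspace) is reduced by this criterion to the vanishing of a vector
  orthogonal to the generators; the error of projecting onto their closed span is such a vector.
\<close>

lemma dense_if_orthogonal_trivial:
  assumes B: "closed_csubspace B" and U: "U \<subseteq> B"
    and triv: "\<And>x. x \<in> B \<Longrightarrow> (\<And>u. u \<in> U \<Longrightarrow> cinner x u = 0) \<Longrightarrow> x = 0"
  shows "B = closure (cfock.span U)"
proof
  show "closure (cfock.span U) \<subseteq> B"
    by (rule closure_span_minimal[OF U B])
  show "B \<subseteq> closure (cfock.span U)"
  proof
    fix x assume x: "x \<in> B"
    obtain p where p: "p \<in> closure (cfock.span U)"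
      and orth: "\<And>y. y \<in> closure (cfock.span U) \<Longrightarrow> cinner (x - p) y = 0"
      using orthogonal_projection_exists_complex[OF closed_csubspace_closure_span] by blast
    have "x - p \<in> B"
      using x p closure_span_minimal[OF U B] B
      by (auto simp: closed_csubspace_def intro!: cfock.subspace_diff)
    then have "x - p = 0"
      using triv orth closure_span_superset by blast
    with p show "x \<in> closure (cfock.span U)"
      by simp
  qed
qed

section \<open>Orthonormal families\<close>

definition orthonormal_on :: "'j set \<Rightarrow> ('j \<Rightarrow> 'n fock) \<Rightarrow> bool"
  where "orthonormal_on J v \<longleftrightarrow> (\<forall>i\<in>J. \<forall>j\<in>J. cinner (v i) (v j) = of_bool (i = j))"

lemma cinner_orthonormal_sum:
  assumes v: "orthonormal_on J v" and F: "finite F" "F \<subseteq> J" and j: "j \<in> F"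
  shows "cinner (\<Sum>i\<in>F. c i *\<^sub>C v i) (v j) = c j"
proof -
  have "cinner (\<Sum>i\<in>F. c i *\<^sub>C v i) (v j) = (\<Sum>i\<in>F. c i * of_bool (i = j))"
    unfolding cinner_simps
    by (rule sum.cong) (use v F(2) j in \<open>simp_all add: orthonormal_on_def subset_iff\<close>)
  then show ?thesis
    using F j by (simp add: of_bool_def if_distrib cong: if_cong)
qed

text \<open>
  The Pythagorean theorem for the decomposition of \<open>x\<close> into its projection onto the span of
  finitely many members and the error.
\<close>

lemma Bessel_identity:
  assumes v: "orthonormal_on J v" and F: "finite F" "F \<subseteq> J"
  shows "(norm (x - (\<Sum>j\<in>F. cinner x (v j) *\<^sub>C v j)))\<^sup>2 = (norm x)\<^sup>2 - (\<Sum>j\<in>F. (cmod (cinner x (v j)))\<^sup>2)"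
proof -
  define p where "p = (\<Sum>j\<in>F. cinner x (v j) *\<^sub>C v j)"
  have pv: "cinner p (v j) = cinner x (v j)" if "j \<in> F" for j
    unfolding p_def by (rule cinner_orthonormal_sum[OF v F that])
  have xp: "cinner x p = of_real (\<Sum>j\<in>F. (cmod (cinner x (v j)))\<^sup>2)"
    unfolding p_def cinner_simps of_real_sum complex_norm_square
    by (simp add: mult.commute)
  have pp: "cinner p p = of_real (\<Sum>j\<in>F. (cmod (cinner x (v j)))\<^sup>2)"
    by (subst (2) p_def) (simp add: cinner_simps pv complex_norm_square mult.commute del: of_real_power)
  have px: "cinner p x = of_real (\<Sum>j\<in>F. (cmod (cinner x (v j)))\<^sup>2)"
    by (subst cnj_cinner[symmetric]) (simp add: xp)
  have "of_real ((norm (x - p))\<^sup>2) = cinner (x - p) (x - p)"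
    by (simp add: cinner_self)
  also have "\<dots> = cinner x x - of_real (\<Sum>j\<in>F. (cmod (cinner x (v j)))\<^sup>2)"
    unfolding cinner_simps xp pp px by simp
  also have "\<dots> = of_real ((norm x)\<^sup>2 - (\<Sum>j\<in>F. (cmod (cinner x (v j)))\<^sup>2))"
    by (simp add: cinner_self)
  finally show ?thesis
    unfolding p_def of_real_eq_iff .
qed

lemma norm_orthonormal_sum:
  assumes v: "orthonormal_on J v" and F: "finite F" "F \<subseteq> J"
  shows "(norm (\<Sum>i\<in>F. c i *\<^sub>C v i))\<^sup>2 = (\<Sum>i\<in>F. (cmod (c i))\<^sup>2)"
  using Bessel_identity[OF v F, of "\<Sum>i\<in>F. c i *\<^sub>C v i"] cinner_orthonormal_sum[OF v F, of _ c]
  by simp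

text \<open>
  An expansion that is stable under enlarging the index set is what the passage to the closure
  needs, since convergence of unordered sums refers to all sufficiently large finite sets.
\<close>

lemma span_expansion:
  assumes v: "orthonormal_on J v" and x: "x \<in> cfock.span (v ` J)"
  shows "\<exists>F. finite F \<and> F \<subseteq> J \<and>
    (\<forall>G. finite G \<longrightarrow> F \<subseteq> G \<longrightarrow> G \<subseteq> J \<longrightarrow> (\<Sum>j\<in>G. cinner x (v j) *\<^sub>C v j) = x)"
  using x
proof (induction rule: cfock.span_induct_alt)
  case base
  then show ?case
    by (intro exI[of _ "{}"]) (simp add: cinner_simps)
next
  case (step c b y)
  then obtain i F where i: "i \<in> J" "b = v i" and F: "finite F" "F \<subseteq> J"
    and y: "\<And>G. finite G \<Longrightarrow> F \<subseteq> G \<Longrightarrow> G \<subseteq> J \<Longrightarrow> (\<Sum>j\<in>G. cinner y (v j) *\<^sub>C v j) = y"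
    by auto
  have "(\<Sum>j\<in>G. cinner (c *\<^sub>C b + y) (v j) *\<^sub>C v j) = c *\<^sub>C b + y"
    if G: "finite G" "insert i F \<subseteq> G" "G \<subseteq> J" for G
  proof -
    have "(\<Sum>j\<in>G. cinner b (v j) *\<^sub>C v j) = (\<Sum>j\<in>G. if j = i then b else 0)"
      by (rule sum.cong) (use G i v in \<open>auto simp: orthonormal_on_def\<close>)
    also have "\<dots> = b"
      using G by simp
    finally have "(\<Sum>j\<in>G. cinner b (v j) *\<^sub>C v j) = b" .
    then show ?thesis
      using y[OF G(1) _ G(3)] G(2)
      by (simp add: cinner_simps cfock.scale_left_distrib sum.distrib
          cfock.scale_scale[symmetric] cfock.scale_sum_right[symmetric] del: cfock.scale_scale)
  qed
  then show ?case
    using F i by (intro exI[of _ "insert i F"]) auto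
qed

text \<open>
  The error of a partial expansion is a contraction in \<open>x\<close> by Bessel's identity, and it vanishes
  for a nearby vector of the span.
\<close>

lemma orthonormal_expansion:
  assumes v: "orthonormal_on J v" and x: "x \<in> closure (cfock.span (v ` J))"
  shows "((\<lambda>j. cinner x (v j) *\<^sub>C v j) has_sum x) J"
  unfolding has_sum_def tendsto_iff
proof (intro allI impI)
  fix e :: real assume "e > 0"
  then obtain y where y: "y \<in> cfock.span (v ` J)" "norm (x - y) < e"
    using x by (auto simp: closure_approachable dist_norm norm_minus_commute)
  obtain F where F: "finite F" "F \<subseteq> J"
    and Fy: "\<And>G. finite G \<Longrightarrow> F \<subseteq> G \<Longrightarrow> G \<subseteq> J \<Longrightarrow> (\<Sum>j\<in>G. cinner y (v j) *\<^sub>C v j) = y"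
    using span_expansion[OF v y(1)] by blast
  show "\<forall>\<^sub>F G in finite_subsets_at_top J. dist (\<Sum>j\<in>G. cinner x (v j) *\<^sub>C v j) x < e"
    unfolding eventually_finite_subsets_at_top
  proof (intro exI conjI allI impI; (elim conjE)?)
    fix G assume G: "finite G" "F \<subseteq> G" "G \<subseteq> J"
    have "x - (\<Sum>j\<in>G. cinner x (v j) *\<^sub>C v j) =
        (x - y) - ((\<Sum>j\<in>G. cinner x (v j) *\<^sub>C v j) - (\<Sum>j\<in>G. cinner y (v j) *\<^sub>C v j))"
      by (simp add: Fy[OF G])
    also have "\<dots> = (x - y) - (\<Sum>j\<in>G. cinner (x - y) (v j) *\<^sub>C v j)"
      by (simp add: cinner_simps cfock.scale_left_diff_distrib sum_subtractf)
    finally have "x - (\<Sum>j\<in>G. cinner x (v j) *\<^sub>C v j) = \<dots>" .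
    moreover have "(norm \<dots>)\<^sup>2 \<le> (norm (x - y))\<^sup>2"
      unfolding Bessel_identity[OF v G(1,3)] by (simp add: sum_nonneg)
    ultimately have "norm (x - (\<Sum>j\<in>G. cinner x (v j) *\<^sub>C v j)) \<le> norm (x - y)"
      by (metis norm_ge_zero power2_le_imp_le)
    with y(2) show "dist (\<Sum>j\<in>G. cinner x (v j) *\<^sub>C v j) x < e"
      by (simp add: dist_norm norm_minus_commute)
  qed (use F in auto)
qed

text \<open>
  Bessel's inequality for the vector of a word \<open>f\<close> bounds the sum of \<open>\<bar>coeff b f\<bar>\<^sup>2\<close>
  over the set, so that only countably many members have a nonzero coefficient at \<open>f\<close>; there are
  countably many words, and each member is nonzero at one of them.
\<close>

lemma orthonormal_set_countable:
  fixes B :: "'n::countable fock set"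
  assumes B: "orthonormal_on B id"
  shows "countable B"
proof -
  have "countable {b\<in>B. coeff b f \<noteq> 0}" for f
  proof -
    have "(\<Sum>b\<in>F. (cmod (coeff b f))\<^sup>2) \<le> 1" if F: "finite F" "F \<subseteq> B" for F
    proof -
      have "(\<Sum>b\<in>F. (cmod (cinner (word_vec f) b))\<^sup>2) \<le> 1"
        using Bessel_identity[OF B F, of "word_vec f"]
          zero_le_power2[of "norm (word_vec f - (\<Sum>b\<in>F. cinner (word_vec f) b *\<^sub>C b))"]
        by simp
      moreover have "cmod (cinner (word_vec f) b) = cmod (coeff b f)" for b
        by (metis cinner_word_vec cnj_cinner complex_mod_cnj)
      ultimately show ?thesis
        by simp
    qed
    then have "(\<lambda>b. (cmod (coeff b f))\<^sup>2) summable_on B"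
      by (intro nonneg_bdd_above_summable_on) (auto intro!: bdd_aboveI[where M = 1])
    from summable_countable_real[OF this] show ?thesis
      by simp
  qed
  then have "countable (\<Union>f. {b\<in>B. coeff b f \<noteq> 0})"
    by (intro countable_UN) auto
  moreover have "B \<subseteq> (\<Union>f. {b\<in>B. coeff b f \<noteq> 0})"
  proof
    fix b assume b: "b \<in> B"
    have "\<exists>f. coeff b f \<noteq> 0"
    proof (rule ccontr)
      assume "\<nexists>f. coeff b f \<noteq> 0"
      then have "b = 0"
        by (intro fock_eqI) simp
      then have "cinner b b = 0"
        by simp
      with B b show False
        by (simp add: orthonormal_on_def)
    qed
    with b show "b \<in> (\<Union>f. {b\<in>B. coeff b f \<noteq> 0})"
      by blast
  qed
  ultimately show ?thesis
    by (rule countable_subset[rotated])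
qed

text \<open>
  A maximal orthonormal subset, provided by Zorn's lemma, has trivial orthogonal complement, for
  a normalized orthogonal vector could be added to it. Countability of the set is what permits
  indices in \<^typ>\<open>nat\<close>.
\<close>

lemma orthonormal_basis_exists:
  fixes L :: "'n::countable fock set"
  assumes L: "closed_csubspace L"
  obtains J :: "nat set" and v where "orthonormal_on J v" and "L = closure (cfock.span (v ` J))"
proof -
  define \<A> where "\<A> = {B. B \<subseteq> L \<and> orthonormal_on B id}"
  have "\<exists>B\<in>\<A>. \<forall>X\<in>\<A>. B \<subseteq> X \<longrightarrow> X = B"
  proof (rule subset_Zorn')
    fix \<C> assume \<C>: "subset.chain \<A> \<C>"
    then have sub: "B \<in> \<A>" if "B \<in> \<C>" for B
      using that by (auto simp: subset_chain_def)
    have "cinner x y = of_bool (x = y)" if "X \<in> \<C>" "Y \<in> \<C>" "x \<in> X" "y \<in> Y" for X Y x y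
    proof -
      obtain Z where "Z \<in> \<C>" "x \<in> Z" "y \<in> Z"
        using \<C> \<open>X \<in> \<C>\<close> \<open>Y \<in> \<C>\<close> \<open>x \<in> X\<close> \<open>y \<in> Y\<close> unfolding subset_chain_def by blast
      then show ?thesis
        using sub by (auto simp: \<A>_def orthonormal_on_def)
    qed
    then have "orthonormal_on (\<Union>\<C>) id"
      by (auto simp: orthonormal_on_def)
    moreover have "\<Union>\<C> \<subseteq> L"
      using sub by (auto simp: \<A>_def)
    ultimately show "\<Union>\<C> \<in> \<A>"
      by (simp add: \<A>_def)
  qed
  then obtain B where "B \<in> \<A>" and max: "\<And>X. X \<in> \<A> \<Longrightarrow> B \<subseteq> X \<Longrightarrow> X = B"
    by blast
  then have BL: "B \<subseteq> L" and on: "orthonormal_on B id"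
    by (auto simp: \<A>_def)
  have LB: "L = closure (cfock.span B)"
  proof (rule dense_if_orthogonal_trivial[OF L BL])
    fix x assume x: "x \<in> L" and orth: "\<And>u. u \<in> B \<Longrightarrow> cinner x u = 0"
    show "x = 0"
    proof (rule ccontr)
      assume "x \<noteq> 0"
      define b where "b = of_real (inverse (norm x)) *\<^sub>C x"
      have "norm b = 1"
        using \<open>x \<noteq> 0\<close> by (simp add: b_def norm_scaleC norm_inverse)
      then have bb: "cinner b b = 1"
        by (simp add: norm_eq_1_iff_cinner)
      have bu: "cinner b u = 0" "cinner u b = 0" if "u \<in> B" for u
        using orth[OF that] cinner_commute_eq_0[of u x] by (auto simp: b_def cinner_simps)
      have "b \<notin> B"
        using bb bu(1) by fastforce
      have "b \<in> L"
        unfolding b_def using L x by (intro cfock.subspace_scale) (auto simp: closed_csubspace_def)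
      moreover have "orthonormal_on (insert b B) id"
        using on bb bu \<open>b \<notin> B\<close> by (auto simp: orthonormal_on_def)
      ultimately have "insert b B = B"
        using BL by (intro max) (auto simp: \<A>_def)
      with \<open>b \<notin> B\<close> show False
        by blast
    qed
  qed
  have "countable B"
    by (rule orthonormal_set_countable[OF on])
  then obtain g :: "_ \<Rightarrow> nat" where g: "inj_on g B"
    by (auto simp: countable_def)
  show thesis
  proof
    show "orthonormal_on (g ` B) (the_inv_into B g)"
      using on g by (auto simp: orthonormal_on_def the_inv_into_f_f inj_on_eq_iff)
    have "the_inv_into B g ` g ` B = B"
      using g by (force simp: the_inv_into_f_f)
    then show "L = closure (cfock.span (the_inv_into B g ` g ` B))"
      using LB by simp
  qed
qed

section \<open>Products and creation operators\<close>

lemma finite_splittings [simp]: "finite {(f, g). f @ g = w}"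
proof (rule finite_subset)
  show "{(f, g). f @ g = w} \<subseteq> (\<lambda>k. (take k w, drop k w)) ` {..length w}"
  proof clarify
    fix f g assume "w = f @ g"
    then show "(f, g) \<in> (\<lambda>k. (take k (f @ g), drop k (f @ g))) ` {..length (f @ g)}"
      by (intro image_eqI[where x = "length f"]) auto
  qed
qed simp

lemma cauchy_product_Nil [simp]: "cauchy_product a b [] = a [] * b []"
proof -
  have "{(f, g). f @ g = []} = {([], [])}"
    by auto
  then show ?thesis
    by (simp add: cauchy_product_def)
qed

text \<open>
  A recursion on the first letter fits the creation operators, which act there: their interplay
  with products becomes a case distinction on the word.
\<close>

lemma cauchy_product_Cons:
  "cauchy_product a b (i # w) = a [] * b (i # w) + cauchy_product (\<lambda>f. a (i # f)) b w"
proof -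
  have *: "{(f, g). f @ g = i # w} =
      insert ([], i # w) ((\<lambda>(f, g). (i # f, g)) ` {(f, g). f @ g = w})"
    by (auto simp: append_eq_Cons_conv)
  have "inj_on (\<lambda>(f, g). (i # f, g)) {(f, g). f @ g = w}"
    by (auto simp: inj_on_def)
  then show ?thesis
    unfolding cauchy_product_def *
    by (subst sum.insert[OF finite_imageI[OF finite_splittings]])
      (auto simp: sum.reindex case_prod_unfold)
qed

lemma cauchy_product_add: "cauchy_product (\<lambda>f. a f + b f) c w = cauchy_product a c w + cauchy_product b c w"
  by (simp add: cauchy_product_def case_prod_unfold distrib_right sum.distrib)

lemma cauchy_product_scale: "cauchy_product (\<lambda>f. z * a f) c w = z * cauchy_product a c w"
  by (simp add: cauchy_product_def case_prod_unfold mult.assoc sum_distrib_left)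

lemma cauchy_product_zero [simp]: "cauchy_product (\<lambda>_. 0) c w = 0"
  by (simp add: cauchy_product_def)

lemma cauchy_product_sum:
  "cauchy_product (\<lambda>f. \<Sum>i\<in>I. a i f) c w = (\<Sum>i\<in>I. cauchy_product (a i) c w)"
  by (induction I rule: infinite_finite_induct) (simp_all add: cauchy_product_add)

lemma cauchy_product_cong:
  "(\<And>f g. f @ g = w \<Longrightarrow> a f = b f) \<Longrightarrow> cauchy_product a c w = cauchy_product b c w"
  unfolding cauchy_product_def by (rule sum.cong) auto

lemma cauchy_product_unit [simp]: "cauchy_product (\<lambda>f. of_bool (f = [])) b = b"
proof
  show "cauchy_product (\<lambda>f. of_bool (f = [])) b w = b w" for w
    by (cases w) (simp_all add: cauchy_product_Cons)
qed

lemma cauchy_product_rev: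
  "cauchy_product (\<lambda>f. a (rev f)) (\<lambda>f. b (rev f)) w = cauchy_product b a (rev w)"
  unfolding cauchy_product_def
  by (rule sum.reindex_bij_witness[where i = "\<lambda>(f, g). (rev g, rev f)" and j = "\<lambda>(f, g). (rev g, rev f)"])
    (auto simp: rev_append[symmetric] simp del: rev_append)

lemma coeff_tensor:
  "sq_summable (cauchy_product (coeff x) (coeff y)) \<Longrightarrow>
    coeff (x \<otimes>\<^sub>F y) = cauchy_product (coeff x) (coeff y)"
  by (simp add: tensor.rep_eq)

lemma flip_flip [simp]: "flip (flip x) = x"
  by (rule fock_eqI) simp

text \<open>
  Square summability is invariant under reversal of words, so both sides take the default value
  \<open>0\<close> in the same cases and no assumption on the factors arises.
\<close>

lemma flip_tensor: "flip (x \<otimes>\<^sub>F y) = flip y \<otimes>\<^sub>F flip x"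
proof (rule fock_eqI)
  fix w
  have "cauchy_product (coeff (flip y)) (coeff (flip x)) =
      (\<lambda>w. cauchy_product (coeff x) (coeff y) (rev w))"
    by (simp add: cauchy_product_rev fun_eq_iff)
  then show "coeff (flip (x \<otimes>\<^sub>F y)) w = coeff (flip y \<otimes>\<^sub>F flip x) w"
    unfolding tensor.rep_eq flip.rep_eq[of "x \<otimes>\<^sub>F y"] by (simp only: sq_summable_rev if_distribR)
qed

lemma cinner_flip: "cinner (flip x) (flip y) = cinner x y"
proof -
  have "bij_betw rev (UNIV :: 'a list set) UNIV"
    by (rule bij_betw_byWitness[where f' = rev]) auto
  from infsum_reindex_bij_betw[OF this, of "\<lambda>f. coeff x f * cnj (coeff y f)"] show ?thesis
    by (simp add: cinner_def)
qed

lemma norm_flip [simp]: "norm (flip x) = norm x"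
  using cinner_flip[of x x] unfolding cinner_self of_real_eq_iff by simp

lemma bounded_linear_flip: "bounded_linear flip"
  by (rule bounded_linear_intro[where K = 1]) (auto intro: fock_eqI)

lemma flip_scaleC: "flip (c *\<^sub>C x) = c *\<^sub>C flip x"
  by (rule fock_eqI) simp

lemma summable_shift_iff:
  fixes g :: "'a list \<Rightarrow> 'b::{comm_monoid_add, topological_space}"
  shows "g summable_on range ((#) i) \<longleftrightarrow> (\<lambda>f. g (i # f)) summable_on UNIV"
  by (subst summable_on_reindex) (simp_all add: o_def)

text \<open>
  The adjoint of \<^const>\<open>left_creation\<close>.
\<close>

lift_definition left_annihilation :: "'n \<Rightarrow> 'n fock \<Rightarrow> 'n fock" is "\<lambda>i a f. a (i # f)"
proof -
  fix i :: 'n and a :: "'n list \<Rightarrow> complex" assume "sq_summable a"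
  then have "(\<lambda>f. (cmod (a f))\<^sup>2) summable_on range ((#) i)"
    unfolding sq_summable_def by (rule summable_on_subset_banach) simp
  then show "sq_summable (\<lambda>f. a (i # f))"
    unfolding summable_shift_iff sq_summable_def .
qed

declare left_annihilation.rep_eq [simp]

text \<open>
  The action of a creation operator on coefficient families. It is stated for arbitrary families
  because it is applied to products whose square summability is still to be shown.
\<close>

definition prepend :: "'n \<Rightarrow> ('n list \<Rightarrow> complex) \<Rightarrow> 'n list \<Rightarrow> complex"
  where "prepend i a h = (case h of [] \<Rightarrow> 0 | j # w \<Rightarrow> if j = i then a w else 0)"

lemma prepend_simps [simp]: "prepend i a [] = 0" "prepend i a (j # w) = (if j = i then a w else 0)"
  by (simp_all add: prepend_def)

lemma prepend_outside: "h \<notin> range ((#) i) \<Longrightarrow> prepend i a h = 0"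
  by (cases h) auto

lemma sq_summable_prepend:
  assumes "sq_summable a"
  shows "sq_summable (prepend i a)"
proof -
  have "(\<lambda>h. (cmod (prepend i a h))\<^sup>2) summable_on range ((#) i)"
    unfolding summable_shift_iff using assms by (simp add: sq_summable_def)
  then show ?thesis
    unfolding sq_summable_def
    by (rule summable_on_cong_neutral[THEN iffD1, rotated -1]) (auto simp: prepend_outside)
qed

lemma cauchy_product_prepend: "cauchy_product (prepend i a) b = prepend i (cauchy_product a b)"
proof
  show "cauchy_product (prepend i a) b w = prepend i (cauchy_product a b) w" for w
    by (cases w) (simp_all add: cauchy_product_Cons)
qed

lemma coeff_left_creation [simp]: "coeff (left_creation i x) = prepend i (coeff x)"
proof -
  have "coeff (word_vec [i]) = prepend i (\<lambda>f. of_bool (f = []))"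
  proof
    show "coeff (word_vec [i]) h = prepend i (\<lambda>f. of_bool (f = [])) h" for h
      by (cases h) auto
  qed
  then have "cauchy_product (coeff (word_vec [i])) (coeff x) = prepend i (coeff x)"
    by (simp add: cauchy_product_prepend del: fock_coeff_simps)
  then show ?thesis
    by (simp add: left_creation_def coeff_tensor sq_summable_prepend sq_summable_coeff del: fock_coeff_simps)
qed

lemma left_annihilation_creation:
  "left_annihilation j (left_creation i x) = (if i = j then x else 0)"
  by (rule fock_eqI) simp

lemma cinner_left_creation: "cinner (left_creation i x) y = cinner x (left_annihilation i y)"
proof -
  have "cinner (left_creation i x) y = (\<Sum>\<^sub>\<infinity>f\<in>range ((#) i). prepend i (coeff x) f * cnj (coeff y f))"
    unfolding cinner_def by (rule infsum_cong_neutral) (auto simp: prepend_outside)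
  also have "\<dots> = cinner x (left_annihilation i y)"
    by (subst infsum_reindex) (simp_all add: cinner_def o_def)
  finally show ?thesis .
qed

lemma cinner_left_creations:
  "cinner (left_creation i x) (left_creation j y) = (if i = j then cinner x y else 0)"
  by (auto simp: cinner_left_creation left_annihilation_creation cinner_simps)

lemma norm_left_creation [simp]: "norm (left_creation i x) = norm x"
  using cinner_left_creations[of i x i x] unfolding cinner_self if_P[OF refl] of_real_eq_iff
  by simp

lemma norm_left_annihilation_le: "norm (left_annihilation i x) \<le> norm x"
proof -
  let ?y = "left_annihilation i x"
  have "norm ?y * norm ?y = left_creation i ?y \<bullet> x"
    by (simp add: inner_fock_def cinner_left_creation cinner_self power2_eq_square)
  also have "\<dots> \<le> norm ?y * norm x"
    using norm_cauchy_schwarz[of "left_creation i ?y" x] by simp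
  finally show ?thesis
    by (cases "norm ?y = 0") (auto simp: mult_le_cancel_left)
qed

lemma bounded_linear_left_annihilation: "bounded_linear (left_annihilation i)"
  by (rule bounded_linear_intro[where K = 1])
    (auto intro: fock_eqI simp: norm_left_annihilation_le)

text \<open>
  The identity is the projection onto the vacuum vector plus \<open>\<Sum>\<^sub>i S\<^sub>i S\<^sub>i\<^sup>*\<close>.
\<close>

lemma fock_decomposition:
  fixes x :: "'n::finite fock"
  shows "x = coeff x [] *\<^sub>C word_vec [] + (\<Sum>i\<in>UNIV. left_creation i (left_annihilation i x))"
proof (rule fock_eqI)
  show "coeff x h = coeff (coeff x [] *\<^sub>C word_vec [] + (\<Sum>i\<in>UNIV. left_creation i (left_annihilation i x))) h" for h
    by (cases h) (simp_all add: if_distrib cong: if_cong)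
qed

lemma word_vec_Cons: "word_vec (i # f) = left_creation i (word_vec f)"
proof (rule fock_eqI)
  show "coeff (word_vec (i # f)) h = coeff (left_creation i (word_vec f)) h" for h
    by (cases h) auto
qed

lemma word_vec_Nil_tensor [simp]: "word_vec [] \<otimes>\<^sub>F x = x"
  by (rule fock_eqI) (simp add: tensor.rep_eq sq_summable_coeff)

lemma left_creation_tensor:
  assumes "sq_summable (cauchy_product (coeff h) (coeff x))"
  shows "left_creation i h \<otimes>\<^sub>F x = left_creation i (h \<otimes>\<^sub>F x)"
  using assms
  by (intro fock_eqI) (simp add: tensor.rep_eq cauchy_product_prepend sq_summable_prepend)

lemma sq_summable_word_vec_product:
  "sq_summable (cauchy_product (coeff (word_vec f)) (coeff x))"
proof (induction f)
  case Nil
  show ?case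
    by (simp add: sq_summable_coeff)
next
  case (Cons i f)
  then show ?case
    unfolding word_vec_Cons coeff_left_creation cauchy_product_prepend
    by (rule sq_summable_prepend)
qed

lemma word_vec_Cons_tensor: "word_vec (i # f) \<otimes>\<^sub>F x = left_creation i (word_vec f \<otimes>\<^sub>F x)"
  unfolding word_vec_Cons by (rule left_creation_tensor[OF sq_summable_word_vec_product])

section \<open>Right multipliers\<close>

text \<open>
  Vectors for which the product with \<open>x\<close> on the right never takes its default value; only then is
  \<open>h \<mapsto> h \<otimes>\<^sub>F x\<close> linear.
\<close>

definition right_multiplier :: "'n fock \<Rightarrow> bool"
  where "right_multiplier x \<longleftrightarrow> (\<forall>h. sq_summable (cauchy_product (coeff h) (coeff x)))"

lemma coeff_tensor_multiplier:
  "right_multiplier x \<Longrightarrow> coeff (h \<otimes>\<^sub>F x) = cauchy_product (coeff h) (coeff x)"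
  by (simp add: right_multiplier_def coeff_tensor)

lemma tensor_add_left: "right_multiplier x \<Longrightarrow> (h + k) \<otimes>\<^sub>F x = h \<otimes>\<^sub>F x + k \<otimes>\<^sub>F x"
  by (rule fock_eqI) (simp add: coeff_tensor_multiplier cauchy_product_add)

lemma tensor_scaleC_left: "right_multiplier x \<Longrightarrow> (c *\<^sub>C h) \<otimes>\<^sub>F x = c *\<^sub>C (h \<otimes>\<^sub>F x)"
  by (rule fock_eqI) (simp add: coeff_tensor_multiplier cauchy_product_scale)

text \<open>
  The product splits along \<open>fock_decomposition\<close> of the left factor. As the sum is finite, \<open>h \<otimes>\<^sub>F x\<close> is
  seen without any limit to differ from a multiple of \<open>x\<close> by images of products \<open>k \<otimes>\<^sub>F x\<close>
  under creation operators.
\<close>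

lemma tensor_recursion:
  fixes x :: "'n::finite fock"
  assumes "right_multiplier x"
  shows "h \<otimes>\<^sub>F x = coeff h [] *\<^sub>C x + (\<Sum>i\<in>UNIV. left_creation i (left_annihilation i h \<otimes>\<^sub>F x))"
proof (rule fock_eqI)
  show "coeff (h \<otimes>\<^sub>F x) w = coeff (coeff h [] *\<^sub>C x +
      (\<Sum>i\<in>UNIV. left_creation i (left_annihilation i h \<otimes>\<^sub>F x))) w" for w
    using assms
    by (cases w) (simp_all add: coeff_tensor_multiplier cauchy_product_Cons if_distrib cong: if_cong)
qed

lemma orthonormal_word_vec: "orthonormal_on UNIV word_vec"
  by (auto simp: orthonormal_on_def cinner_word_vec)

lemma closure_span_word_vec: "closure (cfock.span (range word_vec)) = UNIV"
proof (rule dense_if_orthogonal_trivial[symmetric])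
  fix x :: "'a fock" assume "\<And>u. u \<in> range word_vec \<Longrightarrow> cinner x u = 0"
  then have "coeff x f = 0" for f
    by (metis cinner_word_vec rangeI)
  then show "x = 0"
    by (intro fock_eqI) simp
qed (auto simp: closed_csubspace_def)

lemma word_vec_expansion: "((\<lambda>f. coeff x f *\<^sub>C word_vec f) has_sum x) UNIV"
  using orthonormal_expansion[OF orthonormal_word_vec, of x]
  by (simp add: closure_span_word_vec cinner_word_vec)

lemma closed_csubspace_UNIV_if_word_vec:
  "closed_csubspace S \<Longrightarrow> range word_vec \<subseteq> S \<Longrightarrow> x \<in> S"
  using closure_span_minimal closure_span_word_vec by blast

text \<open>
  The hypothesis mentions the complex scalars, rather than complex linearity of the maps, so that
  the lemma applies to each argument of the sesquilinear inner product.
\<close>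

lemma bounded_linear_eqI_word_vec:
  assumes T: "bounded_linear T" and T': "bounded_linear T'"
    and eq: "\<And>c f. T (c *\<^sub>C word_vec f) = T' (c *\<^sub>C word_vec f)"
  shows "T x = T' x"
  using has_sum_bounded_linear[OF T word_vec_expansion[of x]]
    has_sum_bounded_linear[OF T' word_vec_expansion[of x]]
  by (simp add: o_def eq has_sum_unique)

text \<open>
  The coefficient of \<open>h \<otimes>\<^sub>F x\<close> at \<open>w\<close> involves only the coefficients of \<open>h\<close> at prefixes
  of \<open>w\<close>. On a finite set of words the product therefore agrees with a finite linear combination
  \<open>y\<close> of the \<open>e\<^sub>f \<otimes>\<^sub>F x\<close>, whose norm orthonormality bounds by that of \<open>h\<close>.
\<close>

lemma multiplier_if_orthonormal:
  assumes v: "orthonormal_on UNIV (\<lambda>f. word_vec f \<otimes>\<^sub>F x)"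
  shows "right_multiplier x" and "norm (h \<otimes>\<^sub>F x) \<le> norm h"
proof -
  have bound: "(\<Sum>w\<in>F. (cmod (cauchy_product (coeff h) (coeff x) w))\<^sup>2) \<le> (norm h)\<^sup>2"
    if F: "finite F" for F and h :: "'a fock"
  proof -
    define G where "G = (\<Union>w\<in>F. fst ` {(f, g). f @ g = w})"
    define y where "y = (\<Sum>f\<in>G. coeff h f *\<^sub>C (word_vec f \<otimes>\<^sub>F x))"
    have G: "finite G"
      using F by (simp add: G_def)
    have "coeff y w = cauchy_product (coeff h) (coeff x) w" if "w \<in> F" for w
    proof -
      have "coeff y w = (\<Sum>f\<in>G. cauchy_product (\<lambda>g. coeff h f * coeff (word_vec f) g) (coeff x) w)"
        unfolding y_def coeff_sum scaleC_fock.rep_eq coeff_tensor[OF sq_summable_word_vec_product]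
          cauchy_product_scale ..
      also have "\<dots> = cauchy_product (coeff h) (coeff x) w"
        unfolding cauchy_product_sum[symmetric]
        by (rule cauchy_product_cong)
          (use that G in \<open>force simp: G_def of_bool_def if_distrib cong: if_cong\<close>)
      finally show ?thesis .
    qed
    then have "(\<Sum>w\<in>F. (cmod (cauchy_product (coeff h) (coeff x) w))\<^sup>2) = (\<Sum>w\<in>F. (cmod (coeff y w))\<^sup>2)"
      by simp
    also have "\<dots> \<le> (norm y)\<^sup>2"
      by (rule sum_sq_coeff_le[OF F])
    also have "\<dots> = (\<Sum>f\<in>G. (cmod (coeff h f))\<^sup>2)"
      unfolding y_def by (rule norm_orthonormal_sum[OF v G]) simp
    also have "\<dots> \<le> (norm h)\<^sup>2"
      by (rule sum_sq_coeff_le[OF G])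
    finally show ?thesis .
  qed
  show m: "right_multiplier x"
    unfolding right_multiplier_def using sq_summable_bounded(1)[OF bound] by blast
  have "(norm (h \<otimes>\<^sub>F x))\<^sup>2 \<le> (norm h)\<^sup>2"
    unfolding power2_norm_fock[of "h \<otimes>\<^sub>F x"] coeff_tensor_multiplier[OF m]
    by (rule sq_summable_bounded(2)[OF bound])
  then show "norm (h \<otimes>\<^sub>F x) \<le> norm h"
    by (rule power2_le_imp_le) simp
qed

lemma bounded_linear_tensor:
  assumes m: "right_multiplier x" and le: "\<And>h. norm (h \<otimes>\<^sub>F x) \<le> norm h"
  shows "bounded_linear (\<lambda>h. h \<otimes>\<^sub>F x)"
  by (rule bounded_linear_intro[where K = 1])
    (use le in \<open>simp_all add: tensor_add_left[OF m] scaleR_fock_def tensor_scaleC_left[OF m]\<close>)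

text \<open>
  The case \<open>x = y\<close>, \<open>c = 1\<close> gives isometries, the case \<open>c = 0\<close> gives orthogonality of ranges.
\<close>

lemma cinner_tensor:
  assumes x: "right_multiplier x" "bounded_linear (\<lambda>h. h \<otimes>\<^sub>F x)"
    and y: "right_multiplier y" "bounded_linear (\<lambda>h. h \<otimes>\<^sub>F y)"
    and xy: "\<And>f g. cinner (word_vec f \<otimes>\<^sub>F x) (word_vec g \<otimes>\<^sub>F y) = of_bool (f = g) * c"
  shows "cinner (h \<otimes>\<^sub>F x) (k \<otimes>\<^sub>F y) = cinner h k * c"
proof -
  have *: "cinner (h \<otimes>\<^sub>F x) (word_vec g \<otimes>\<^sub>F y) = cinner h (word_vec g) * c" for g h
  proof (rule bounded_linear_eqI_word_vec[where x = h])
    show "bounded_linear (\<lambda>h. cinner (h \<otimes>\<^sub>F x) (word_vec g \<otimes>\<^sub>F y))"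
      by (rule bounded_linear_compose[OF bounded_linear_cinner_left x(2)])
    show "bounded_linear (\<lambda>h. cinner h (word_vec g) * c)"
      by (rule bounded_linear_mult_const[OF bounded_linear_cinner_left])
    show "cinner ((z *\<^sub>C word_vec f) \<otimes>\<^sub>F x) (word_vec g \<otimes>\<^sub>F y) = cinner (z *\<^sub>C word_vec f) (word_vec g) * c" for z f
      by (simp add: tensor_scaleC_left[OF x(1)] cinner_scaleC_left xy cinner_word_vec)
  qed
  show ?thesis
  proof (rule bounded_linear_eqI_word_vec[where x = k])
    show "bounded_linear (\<lambda>k. cinner (h \<otimes>\<^sub>F x) (k \<otimes>\<^sub>F y))"
      by (rule bounded_linear_compose[OF bounded_linear_cinner_right y(2)])
    show "bounded_linear (\<lambda>k. cinner h k * c)"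
      by (rule bounded_linear_mult_const[OF bounded_linear_cinner_right])
    show "cinner (h \<otimes>\<^sub>F x) ((z *\<^sub>C word_vec g) \<otimes>\<^sub>F y) = cinner h (z *\<^sub>C word_vec g) * c" for z g
      by (simp add: tensor_scaleC_left[OF y(1)] cinner_scaleC_right *)
  qed
qed

section \<open>Inner functions as isometric right multipliers\<close>

definition isometric_multiplier :: "'n fock \<Rightarrow> bool"
  where "isometric_multiplier x \<longleftrightarrow> right_multiplier x \<and> (\<forall>h. norm (h \<otimes>\<^sub>F x) = norm h)"

lemma bounded_linear_isometric_multiplier:
  "isometric_multiplier x \<Longrightarrow> bounded_linear (\<lambda>h. h \<otimes>\<^sub>F x)"
  unfolding isometric_multiplier_def by (rule bounded_linear_tensor) simp_all

text \<open>
  Polarization, applied to \<open>h\<close> and to \<open>- \<i> h\<close>.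
\<close>

lemma cinner_isometric_multiplier:
  assumes x: "isometric_multiplier x"
  shows "cinner (h \<otimes>\<^sub>F x) (k \<otimes>\<^sub>F x) = cinner h k"
proof -
  have m: "right_multiplier x" and n: "\<And>h. norm (h \<otimes>\<^sub>F x) = norm h"
    using x by (simp_all add: isometric_multiplier_def)
  have "(h \<otimes>\<^sub>F x) \<bullet> (k \<otimes>\<^sub>F x) = h \<bullet> k" for h k
    unfolding dot_norm tensor_add_left[OF m, symmetric] n ..
  then show ?thesis
    unfolding cinner_eq_inner tensor_scaleC_left[OF m, symmetric] by simp
qed

lemma isometric_multiplier_if_orthonormal:
  assumes "orthonormal_on UNIV (\<lambda>f. word_vec f \<otimes>\<^sub>F x)"
  shows "isometric_multiplier x"
proof -
  note m = multiplier_if_orthonormal(1)[OF assms]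
  note bl = bounded_linear_tensor[OF m multiplier_if_orthonormal(2)[OF assms]]
  have "cinner (word_vec f \<otimes>\<^sub>F x) (word_vec g \<otimes>\<^sub>F x) = of_bool (f = g) * 1" for f g
    using assms unfolding orthonormal_on_def by simp
  from cinner_tensor[OF m bl m bl this]
  have "cinner (h \<otimes>\<^sub>F x) (h \<otimes>\<^sub>F x) = cinner h h" for h
    by simp
  then have "(norm (h \<otimes>\<^sub>F x))\<^sup>2 = (norm h)\<^sup>2" for h
    unfolding cinner_self of_real_eq_iff .
  with m show ?thesis
    by (simp add: isometric_multiplier_def)
qed

lemma closed_csubspace_range_multiplier:
  assumes x: "isometric_multiplier x"
  shows "closed_csubspace (range (\<lambda>h. h \<otimes>\<^sub>F x))"
  unfolding closed_csubspace_def
proof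
  have m: "right_multiplier x" and n: "\<And>h. norm (h \<otimes>\<^sub>F x) = norm h"
    using x by (simp_all add: isometric_multiplier_def)
  have "0 \<otimes>\<^sub>F x = 0"
    using n[of 0] by simp
  then show "cfock.subspace (range (\<lambda>h. h \<otimes>\<^sub>F x))"
    by (intro cfock.subspaceI)
      (auto simp: tensor_add_left[OF m, symmetric] tensor_scaleC_left[OF m, symmetric]
        intro: range_eqI[where x = 0])
  show "closed (range (\<lambda>h. h \<otimes>\<^sub>F x))"
    using complete_isometric_image[of 1 UNIV "\<lambda>h. h \<otimes>\<^sub>F x"]
      bounded_linear_isometric_multiplier[OF x]
    by (simp add: n complete_UNIV complete_imp_closed)
qed

lemma tensor_eq_flip: "x \<otimes>\<^sub>F h = flip (flip h \<otimes>\<^sub>F flip x)"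
  by (simp add: flip_tensor)

text \<open>
  The flip exchanges left and right multiplication. An inner function yields an everywhere defined
  product because the default value \<open>0\<close> would violate the norm identity, except at \<open>h = 0\<close>, where
  the product is defined anyway; conversely, an isometry has norm at most \<open>1\<close> as a multiplier.
\<close>

lemma inner_function_iff: "inner_function x \<longleftrightarrow> isometric_multiplier (flip x)"
proof
  assume "inner_function x"
  then have n: "norm (h \<otimes>\<^sub>F flip x) = norm h" for h
    unfolding inner_function_def by (metis norm_flip tensor_eq_flip flip_flip)
  have "sq_summable (cauchy_product (coeff h) (coeff (flip x)))" for h
  proof (rule ccontr)
    assume h: "\<not> sq_summable (cauchy_product (coeff h) (coeff (flip x)))"
    then have "h \<otimes>\<^sub>F flip x = 0"
      by (intro fock_eqI) (simp add: tensor.rep_eq del: fock_coeff_simps(6))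
    then have "h = 0"
      using n[of h] by simp
    then have "cauchy_product (coeff h) (coeff (flip x)) = (\<lambda>_. 0)"
      by (intro ext) simp
    then show False
      using h sq_summable_0 by metis
  qed
  with n show "isometric_multiplier (flip x)"
    by (simp add: isometric_multiplier_def right_multiplier_def)
next
  assume "isometric_multiplier (flip x)"
  then have n: "norm (x \<otimes>\<^sub>F h) = norm h" for h
    unfolding isometric_multiplier_def by (metis norm_flip tensor_eq_flip)
  have "norm_inf x \<le> 1"
    unfolding norm_inf_def by (rule SUP_least) (simp add: n)
  then have "x \<in> F_infinity"
    unfolding F_infinity_def mem_Collect_eq by (rule order.strict_trans1) simp
  with n show "inner_function x"
    by (simp add: inner_function_def)
qed

lemma orthogonal_sets_flip:
  "orthogonal_sets (range (\<lambda>h. x \<otimes>\<^sub>F h)) (range (\<lambda>h. y \<otimes>\<^sub>F h)) \<longleftrightarrow>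
   orthogonal_sets (range (\<lambda>h. h \<otimes>\<^sub>F flip x)) (range (\<lambda>h. h \<otimes>\<^sub>F flip y))"
proof -
  have "range (\<lambda>h. x \<otimes>\<^sub>F h) = flip ` range (\<lambda>h. h \<otimes>\<^sub>F flip x)" for x :: "'a fock"
  proof -
    have "range (\<lambda>h. x \<otimes>\<^sub>F h) = range ((\<lambda>k. flip (k \<otimes>\<^sub>F flip x)) \<circ> flip)"
      by (subst tensor_eq_flip) (simp add: o_def)
    also have "\<dots> = (\<lambda>k. flip (k \<otimes>\<^sub>F flip x)) ` range flip"
      by (rule image_comp[symmetric])
    also have "range flip = (UNIV :: 'a fock set)"
      by (rule surjI[where f = flip]) simp
    finally show ?thesis
      by (simp add: image_image)
  qed
  then show ?thesis
    by (simp add: orthogonal_sets_def cinner_flip)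
qed

text \<open>
  After the flip, orthogonality of the inner functions and orthogonality of the summands are the
  same condition, and the summands are closed as isometric images of a complete space.
\<close>

lemma represents_iff:
  fixes \<phi> :: "'j \<Rightarrow> 'n fock"
  shows "represents J \<phi> M \<longleftrightarrow>
    (\<forall>j\<in>J. isometric_multiplier (flip (\<phi> j))) \<and>
    (\<forall>i\<in>J. \<forall>j\<in>J. i \<noteq> j \<longrightarrow>
      (\<forall>h k. cinner (h \<otimes>\<^sub>F flip (\<phi> i)) (k \<otimes>\<^sub>F flip (\<phi> j)) = 0)) \<and>
    M = closure (cfock.span (\<Union>j\<in>J. range (\<lambda>h. h \<otimes>\<^sub>F flip (\<phi> j))))"
proof -
  have *: "orthogonal_sets (range (\<lambda>h. h \<otimes>\<^sub>F x)) (range (\<lambda>h. h \<otimes>\<^sub>F y)) \<longleftrightarrow>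
      (\<forall>h k. cinner (h \<otimes>\<^sub>F x) (k \<otimes>\<^sub>F y) = 0)" for x y :: "'n fock"
    by (simp add: orthogonal_sets_def)
  have cl: "\<forall>j\<in>J. closed_csubspace (range (\<lambda>h. h \<otimes>\<^sub>F flip (\<phi> j)))"
    if "\<forall>j\<in>J. isometric_multiplier (flip (\<phi> j))"
    using that by (simp add: closed_csubspace_range_multiplier)
  show ?thesis
    unfolding represents_def orthogonal_inner_functions_def is_hilbert_sum_def
      inner_function_iff orthogonal_sets_flip *
    by (rule iffI; elim conjE; intro conjI; (assumption | erule cl))
qed

section \<open>The wandering subspace of an invariant subspace\<close>

definition left_invariant :: "'n fock set \<Rightarrow> bool"
  where "left_invariant M \<longleftrightarrow> closed_csubspace M \<and> (\<forall>i. left_creation i ` M \<subseteq> M)"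

definition wandering :: "'n fock set \<Rightarrow> 'n fock set"
  where "wandering M = {x \<in> M. \<forall>i. \<forall>m\<in>M. cinner x (left_creation i m) = 0}"

lemma left_creation_invariant: "left_invariant M \<Longrightarrow> x \<in> M \<Longrightarrow> left_creation i x \<in> M"
  unfolding left_invariant_def by blast

lemma closed_csubspace_invariant: "left_invariant M \<Longrightarrow> closed_csubspace M"
  by (simp add: left_invariant_def)

lemma csubspace_invariant: "left_invariant M \<Longrightarrow> cfock.subspace M"
  by (simp add: left_invariant_def closed_csubspace_def)

lemma wandering_subset: "wandering M \<subseteq> M"
  by (auto simp: wandering_def)

lemma closed_csubspace_wandering:
  assumes "left_invariant M"
  shows "closed_csubspace (wandering M)"
proof -
  have "wandering M = M \<inter> {x. \<forall>u\<in>(\<Union>i. left_creation i ` M). cinner x u = 0}"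
    by (auto simp: wandering_def)
  then show ?thesis
    by (simp only: closed_csubspace_Int closed_csubspace_invariant[OF assms]
        closed_csubspace_annihilator)
qed

lemma word_vec_tensor_invariant:
  assumes "left_invariant M" "x \<in> M"
  shows "word_vec f \<otimes>\<^sub>F x \<in> M"
  by (induction f) (simp_all add: word_vec_Cons_tensor assms left_creation_invariant)

text \<open>
  The vectors \<open>h\<close> with \<open>h \<otimes>\<^sub>F x \<in> M\<close> form a closed subspace, which contains the words by
  invariance.
\<close>

lemma tensor_invariant:
  assumes M: "left_invariant M" and x: "x \<in> M" "isometric_multiplier x"
  shows "h \<otimes>\<^sub>F x \<in> M"
proof -
  have m: "right_multiplier x" and 0: "0 \<otimes>\<^sub>F x = 0"
    using x(2) norm_eq_zero unfolding isometric_multiplier_def by (blast, metis)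
  let ?S = "(\<lambda>h. h \<otimes>\<^sub>F x) -` M"
  have "closed ?S"
    using M by (intro closed_vimage linear_continuous_on bounded_linear_isometric_multiplier x)
      (simp add: left_invariant_def closed_csubspace_def)
  moreover have "cfock.subspace ?S"
    by (rule cfock.subspaceI)
      (simp_all add: 0 tensor_add_left[OF m] tensor_scaleC_left[OF m] cfock.subspace_0
        cfock.subspace_add cfock.subspace_scale csubspace_invariant[OF M])
  ultimately have "h \<in> ?S"
    by (intro closed_csubspace_UNIV_if_word_vec)
      (auto simp: closed_csubspace_def word_vec_tensor_invariant[OF M x(1)])
  then show ?thesis
    by simp
qed

text \<open>
  Creation operators are isometries with orthogonal ranges, so a common prefix of \<open>f\<close> and \<open>g\<close>
  cancels and different first letters give \<open>0\<close>. If one word is used up before the other, a vector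
  of the wandering subspace meets the image of \<open>M\<close> under a creation operator.
\<close>

lemma wandering_translates_orthogonal:
  assumes M: "left_invariant M" and x: "x \<in> wandering M" and y: "y \<in> wandering M"
  shows "cinner (word_vec f \<otimes>\<^sub>F x) (word_vec g \<otimes>\<^sub>F y) = of_bool (f = g) * cinner x y"
proof (induction f arbitrary: g)
  case Nil
  have "word_vec g \<otimes>\<^sub>F y \<in> M" for g
    using y by (intro word_vec_tensor_invariant[OF M]) (simp add: wandering_def)
  with x show ?case
    by (cases g) (simp_all add: word_vec_Cons_tensor wandering_def)
next
  case (Cons i f)
  have "word_vec f \<otimes>\<^sub>F x \<in> M"
    using x by (intro word_vec_tensor_invariant[OF M]) (simp add: wandering_def)
  then have "cinner y (left_creation i (word_vec f \<otimes>\<^sub>F x)) = 0"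
    using y by (simp add: wandering_def)
  then have "cinner (left_creation i (word_vec f \<otimes>\<^sub>F x)) y = 0"
    by (simp add: cinner_commute_eq_0)
  with Cons show ?case
    by (cases g) (simp_all add: word_vec_Cons_tensor cinner_left_creations)
qed

text \<open>
  Together with \<open>fock_decomposition\<close>, the conclusion says that \<open>x\<close> lies in the sum of the
  images of \<open>M\<close> under the creation operators. The sum is treated in exactly this form, as the set
  \<open>R\<close> below, because closedness of \<open>R\<close> is then obvious. The error of projecting \<open>x\<close> onto \<open>R\<close> is in
  the wandering subspace, hence orthogonal to \<open>x\<close> as well as to \<open>R\<close>, hence \<open>0\<close>.
\<close>

lemma orthogonal_wandering_imp_shifted:
  fixes M :: "'n::finite fock set"
  assumes M: "left_invariant M" and x: "x \<in> M"
    and orth: "\<And>y. y \<in> wandering M \<Longrightarrow> cinner x y = 0"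
  shows "coeff x [] = 0" and "left_annihilation i x \<in> M"
proof -
  define R where "R = {x. coeff x [] = 0 \<and> (\<forall>i. left_annihilation i x \<in> M)}"
  have R_eq: "R = (\<lambda>x. coeff x []) -` {0} \<inter> (\<Inter>i. left_annihilation i -` M)"
    by (auto simp: R_def)
  have "closed R"
    unfolding R_eq using M
    by (intro closed_Int closed_INT ballI closed_vimage linear_continuous_on
        bounded_linear_coeff bounded_linear_left_annihilation)
      (auto simp: left_invariant_def closed_csubspace_def)
  moreover have "cfock.subspace R"
  proof (rule cfock.subspaceI)
    note la = bounded_linear.linear[OF bounded_linear_left_annihilation]
    show "0 \<in> R"
      by (simp add: R_def linear_0[OF la] cfock.subspace_0[OF csubspace_invariant[OF M]])
    show "x + y \<in> R" if "x \<in> R" "y \<in> R" for x y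
      using that by (simp add: R_def linear_add[OF la] cfock.subspace_add[OF csubspace_invariant[OF M]])
    show "c *\<^sub>C x \<in> R" if "x \<in> R" for c x
    proof -
      have "left_annihilation i (c *\<^sub>C x) = c *\<^sub>C left_annihilation i x" for i
        by (rule fock_eqI) simp
      with that show ?thesis
        by (simp add: R_def cfock.subspace_scale[OF csubspace_invariant[OF M]])
    qed
  qed
  ultimately have R: "closed_csubspace R"
    by (simp add: closed_csubspace_def)
  obtain p where p: "p \<in> R" and perp: "\<And>y. y \<in> R \<Longrightarrow> cinner (x - p) y = 0"
    using orthogonal_projection_exists_complex[OF R] by blast
  have "p = (\<Sum>i\<in>UNIV. left_creation i (left_annihilation i p))"
    using fock_decomposition[of p] p by (simp add: R_def)
  moreover have "\<dots> \<in> M"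
    using p by (intro cfock.subspace_sum csubspace_invariant[OF M] left_creation_invariant[OF M])
      (simp add: R_def)
  ultimately have "p \<in> M"
    by simp
  then have "x - p \<in> M"
    using x by (intro cfock.subspace_diff csubspace_invariant[OF M])
  moreover have "left_creation i m \<in> R" if "m \<in> M" for i m
    using that cfock.subspace_0[OF csubspace_invariant[OF M]]
    by (simp add: R_def left_annihilation_creation)
  ultimately have "x - p \<in> wandering M"
    using perp by (simp add: wandering_def)
  then have "cinner x (x - p) = 0"
    by (rule orth)
  moreover have "cinner p (x - p) = 0"
    using perp[OF p] by (simp add: cinner_commute_eq_0)
  ultimately have "cinner (x - p) (x - p) = 0"
    by (simp add: cinner_left_simps(2)[of _ _ "x - p"])
  then have "x \<in> R"
    using p by simp
  then show "coeff x [] = 0" "left_annihilation i x \<in> M"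
    by (simp_all add: R_def)
qed

text \<open>
  Removing a first letter from \<open>x\<close> leads again to a vector of \<open>M\<close> that is orthogonal to all
  translates, so the coefficients of \<open>x\<close> can be computed letter by letter and end in a vacuum
  coefficient, which is \<open>0\<close>.
\<close>

lemma zero_if_orthogonal_translates:
  fixes M :: "'n::finite fock set"
  assumes M: "left_invariant M" and L: "wandering M = closure (cfock.span (v ` J))"
    and x: "x \<in> M" and orth: "\<And>j f. j \<in> J \<Longrightarrow> cinner x (word_vec f \<otimes>\<^sub>F v j) = 0"
  shows "x = 0"
proof (rule fock_eqI)
  fix w
  have perp: "cinner x y = 0"
    if "\<And>j f. j \<in> J \<Longrightarrow> cinner x (word_vec f \<otimes>\<^sub>F v j) = 0" and y: "y \<in> wandering M" for x y
  proof -
    have "cinner (v j) x = 0" if "j \<in> J" for j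
      using \<open>\<And>j f. j \<in> J \<Longrightarrow> cinner x (word_vec f \<otimes>\<^sub>F v j) = 0\<close>[OF that, of "[]"]
      by (simp add: cinner_commute_eq_0)
    then have "cinner y x = 0"
      using y unfolding L by (intro orthogonal_closure_span[of "v ` J" x y]) auto
    then show ?thesis
      by (simp add: cinner_commute_eq_0)
  qed
  show "coeff x w = coeff 0 w"
    using x orth
  proof (induction w arbitrary: x)
    case (Nil x)
    show ?case
      using orthogonal_wandering_imp_shifted(1)[OF M Nil(1) perp[OF Nil(2)]] by simp
  next
    case (Cons i w x)
    have "left_annihilation i x \<in> M"
      by (rule orthogonal_wandering_imp_shifted(2)[OF M Cons.prems(1) perp[OF Cons.prems(2)]])
    moreover have "cinner (left_annihilation i x) (word_vec f \<otimes>\<^sub>F v j) = 0" if "j \<in> J" for j f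
    proof -
      have "cinner (word_vec (i # f) \<otimes>\<^sub>F v j) x = 0"
        using Cons.prems(2)[OF that, of "i # f"] by (simp add: cinner_commute_eq_0)
      then show ?thesis
        by (simp add: word_vec_Cons_tensor cinner_left_creation cinner_commute_eq_0)
    qed
    ultimately have "coeff (left_annihilation i x) w = coeff 0 w"
      by (rule Cons.IH)
    then show ?case
      by simp
  qed
qed

text \<open>
  Translates of orthonormal vectors of the wandering subspace are orthonormal, which
  makes the right multiplications isometric with orthogonal ranges; translates of a basis fill \<open>M\<close>.
\<close>

lemma wandering_basis_represents:
  fixes M :: "'n::finite fock set"
  assumes M: "left_invariant M"
    and v: "orthonormal_on J v" and L: "wandering M = closure (cfock.span (v ` J))"
  shows "represents J (\<lambda>j. flip (v j)) M"
proof -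
  have vL: "v j \<in> wandering M" if "j \<in> J" for j
    unfolding L using that closure_span_superset by blast
  have iso: "isometric_multiplier (v j)" if "j \<in> J" for j
    using wandering_translates_orthogonal[OF M vL vL] v that
    by (intro isometric_multiplier_if_orthonormal) (simp add: orthonormal_on_def)
  have "cinner (h \<otimes>\<^sub>F v i) (k \<otimes>\<^sub>F v j) = 0" if "i \<in> J" "j \<in> J" "i \<noteq> j" for i j h k
  proof -
    have "cinner (h \<otimes>\<^sub>F v i) (k \<otimes>\<^sub>F v j) = cinner h k * 0"
      using iso that v wandering_translates_orthogonal[OF M vL vL, OF that(1,2)]
      by (intro cinner_tensor bounded_linear_isometric_multiplier)
        (simp_all add: isometric_multiplier_def orthonormal_on_def)
    then show ?thesis
      by simp
  qed
  moreover have "M = closure (cfock.span (\<Union>j\<in>J. range (\<lambda>h. h \<otimes>\<^sub>F v j)))"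
  proof (rule dense_if_orthogonal_trivial[OF closed_csubspace_invariant[OF M]])
    show "(\<Union>j\<in>J. range (\<lambda>h. h \<otimes>\<^sub>F v j)) \<subseteq> M"
      using tensor_invariant[OF M _ iso] vL wandering_subset by blast
    show "x = 0" if "x \<in> M" "\<And>u. u \<in> (\<Union>j\<in>J. range (\<lambda>h. h \<otimes>\<^sub>F v j)) \<Longrightarrow> cinner x u = 0" for x
      by (rule zero_if_orthogonal_translates[OF M L that(1)]) (rule that(2), blast)
  qed
  ultimately show ?thesis
    unfolding represents_iff using iso by simp
qed

text \<open>
  Whatever the representation, it comes from an orthonormal basis of the wandering
  subspace. Each \<open>v j = flip (\<phi> j)\<close> is orthogonal to all \<open>left_creation i u\<close> with \<open>u\<close> in a
  summand, since \<open>left_creation i (h \<otimes>\<^sub>F v l)\<close> is a product with \<open>v l\<close> whose left factor has no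
  vacuum coefficient. Conversely, a wandering vector orthogonal to all \<open>v j\<close> is, by
  \<open>tensor_recursion\<close>, orthogonal to every \<open>h \<otimes>\<^sub>F v j\<close>, thus to \<open>M\<close> and to itself.
\<close>

lemma represents_imp_wandering_basis:
  fixes M :: "'n::finite fock set"
  assumes M: "left_invariant M" and rep: "represents J \<phi> M"
  shows "orthonormal_on J (\<lambda>j. flip (\<phi> j))"
    and "wandering M = closure (cfock.span ((\<lambda>j. flip (\<phi> j)) ` J))"
proof -
  define v where "v j = flip (\<phi> j)" for j
  have iso: "isometric_multiplier (v j)" if "j \<in> J" for j
    using rep that by (simp add: represents_iff v_def)
  have orth: "cinner (h \<otimes>\<^sub>F v i) (k \<otimes>\<^sub>F v j) = 0" if "i \<in> J" "j \<in> J" "i \<noteq> j" for i j h k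
    using rep that by (simp add: represents_iff v_def)
  have M_eq: "M = closure (cfock.span (\<Union>j\<in>J. range (\<lambda>h. h \<otimes>\<^sub>F v j)))"
    using rep by (simp add: represents_iff v_def)
  have inner: "cinner (v i) (k \<otimes>\<^sub>F v j) = of_bool (i = j) * cnj (coeff k [])" if "i \<in> J" "j \<in> J" for i j k
  proof (cases "i = j")
    case True
    have "cinner (v i) (k \<otimes>\<^sub>F v i) = cinner (word_vec []) k"
      using cinner_isometric_multiplier[OF iso[OF that(1)], of "word_vec []" k] by simp
    also have "\<dots> = cnj (coeff k [])"
      by (metis cinner_word_vec cnj_cinner)
    finally show ?thesis
      using True by simp
  next
    case False
    then show ?thesis
      using orth[OF that False, of "word_vec []" k] by simp
  qed
  show on: "orthonormal_on J (\<lambda>j. flip (\<phi> j))"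
    unfolding orthonormal_on_def v_def[symmetric]
  proof (intro ballI)
    show "cinner (v i) (v j) = of_bool (i = j)" if "i \<in> J" "j \<in> J" for i j
      using inner[OF that, of "word_vec []"] by simp
  qed
  have vM: "v j \<in> M" if "j \<in> J" for j
  proof -
    have "word_vec [] \<otimes>\<^sub>F v j \<in> (\<Union>j\<in>J. range (\<lambda>h. h \<otimes>\<^sub>F v j))"
      using that by blast
    then have "word_vec [] \<otimes>\<^sub>F v j \<in> M"
      unfolding M_eq by (rule subsetD[OF closure_span_superset])
    then show ?thesis
      by simp
  qed
  have vL: "v j \<in> wandering M" if j: "j \<in> J" for j
    unfolding wandering_def mem_Collect_eq
  proof (intro conjI allI ballI)
    show "v j \<in> M"
      by (rule vM[OF j])
    fix i m assume "m \<in> M"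
    have "cinner m (left_annihilation i (v j)) = 0"
    proof (rule orthogonal_closure_span)
      show "m \<in> closure (cfock.span (\<Union>j\<in>J. range (\<lambda>h. h \<otimes>\<^sub>F v j)))"
        using \<open>m \<in> M\<close> M_eq by simp
      fix u assume "u \<in> (\<Union>j\<in>J. range (\<lambda>h. h \<otimes>\<^sub>F v j))"
      then obtain l h where l: "l \<in> J" and u: "u = h \<otimes>\<^sub>F v l"
        by blast
      have "left_creation i u = left_creation i h \<otimes>\<^sub>F v l"
        using iso[OF l] unfolding u isometric_multiplier_def right_multiplier_def
        by (simp add: left_creation_tensor)
      then have "cinner (v j) (left_creation i u) = 0"
        by (simp add: inner[OF j l])
      then show "cinner u (left_annihilation i (v j)) = 0"
        unfolding cinner_left_creation[symmetric] by (rule cinner_commute_eq_0[THEN iffD1])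
    qed
    then show "cinner (v j) (left_creation i m) = 0"
      unfolding cinner_left_creation[symmetric] by (rule cinner_commute_eq_0[THEN iffD1])
  qed
  have "wandering M = closure (cfock.span (v ` J))"
  proof (rule dense_if_orthogonal_trivial[OF closed_csubspace_wandering[OF M]])
    show "v ` J \<subseteq> wandering M"
      using vL by blast
    fix x assume x: "x \<in> wandering M" and xv: "\<And>u. u \<in> v ` J \<Longrightarrow> cinner x u = 0"
    have "cinner (h \<otimes>\<^sub>F v j) x = 0" if j: "j \<in> J" for h j
    proof -
      have "h \<otimes>\<^sub>F v j = coeff h [] *\<^sub>C v j + (\<Sum>i\<in>UNIV. left_creation i (left_annihilation i h \<otimes>\<^sub>F v j))"
        using iso[OF j] by (intro tensor_recursion) (simp add: isometric_multiplier_def)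
      moreover have "cinner x (left_creation i (left_annihilation i h \<otimes>\<^sub>F v j)) = 0" for i
        using x tensor_invariant[OF M vM[OF j] iso[OF j]] by (simp add: wandering_def)
      ultimately have "cinner x (h \<otimes>\<^sub>F v j) = 0"
        using xv j by (simp add: cinner_simps)
      then show ?thesis
        by (simp add: cinner_commute_eq_0)
    qed
    then have "cinner u x = 0" if "u \<in> (\<Union>j\<in>J. range (\<lambda>h. h \<otimes>\<^sub>F v j))" for u
      using that by blast
    moreover have "x \<in> closure (cfock.span (\<Union>j\<in>J. range (\<lambda>h. h \<otimes>\<^sub>F v j)))"
      using x by (simp only: M_eq[symmetric] subsetD[OF wandering_subset])
    ultimately have "cinner x x = 0"
      by (rule orthogonal_closure_span)
    then show "x = 0"
      by simp
  qed
  then show "wandering M = closure (cfock.span ((\<lambda>j. flip (\<phi> j)) ` J))"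
    by (simp add: v_def)
qed

text \<open>
  The rows of the matrix of inner products are the expansions of one basis in the other, and its
  columns are the conjugated expansions in the opposite direction; pairing an expansion with a
  further basis vector gives the orthonormality relations.
\<close>

lemma essentially_equal_if_same_closed_span:
  assumes \<phi>: "orthonormal_on J (\<lambda>j. flip (\<phi> j))" and \<psi>: "orthonormal_on K (\<lambda>k. flip (\<psi> k))"
    and eq: "closure (cfock.span ((\<lambda>j. flip (\<phi> j)) ` J)) = closure (cfock.span ((\<lambda>k. flip (\<psi> k)) ` K))"
  shows "essentially_equal J \<phi> K \<psi>"
proof -
  define v where "v = (\<lambda>j. flip (\<phi> j))"
  define w where "w = (\<lambda>k. flip (\<psi> k))"
  define u where "u k j = cinner (w k) (v j)" for k j
  have v: "orthonormal_on J v" and w: "orthonormal_on K w"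
    and eq: "closure (cfock.span (v ` J)) = closure (cfock.span (w ` K))"
    using assms by (simp_all add: v_def w_def)
  have exp_w: "((\<lambda>j. u k j *\<^sub>C v j) has_sum w k) J" if "k \<in> K" for k
    unfolding u_def using that closure_span_superset[of "w ` K"] eq
    by (intro orthonormal_expansion[OF v]) blast
  have exp_v: "((\<lambda>k. cnj (u k j) *\<^sub>C w k) has_sum v j) K" if "j \<in> J" for j
    unfolding u_def cnj_cinner using that closure_span_superset[of "v ` J"] eq
    by (intro orthonormal_expansion[OF w]) blast
  have "((\<lambda>j. u k j * cnj (u l j)) has_sum of_bool (k = l)) J" if "k \<in> K" "l \<in> K" for k l
    using has_sum_bounded_linear[OF bounded_linear_cinner_left exp_w[OF that(1)], of "w l"] w that
    by (simp add: cinner_simps u_def cnj_cinner orthonormal_on_def)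
  moreover have "((\<lambda>k. u k i * cnj (u k j)) has_sum of_bool (i = j)) K" if "i \<in> J" "j \<in> J" for i j
  proof -
    have "((\<lambda>k. cnj (u k j) * u k i) has_sum cinner (v j) (v i)) K"
      using has_sum_bounded_linear[OF bounded_linear_cinner_left exp_v[OF that(2)], of "v i"]
      by (simp add: cinner_simps u_def)
    moreover have "cinner (v j) (v i) = of_bool (i = j)"
      using v that by (auto simp: orthonormal_on_def)
    ultimately show ?thesis
      by (simp add: mult.commute)
  qed
  ultimately have "unitary_matrix K J u"
    by (simp add: unitary_matrix_def)
  moreover have "((\<lambda>j. u k j *\<^sub>C \<phi> j) has_sum \<psi> k) J" if "k \<in> K" for k
    using has_sum_bounded_linear[OF bounded_linear_flip exp_w[OF that]]
    by (simp add: flip_scaleC v_def w_def)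
  ultimately show ?thesis
    unfolding essentially_equal_def by blast
qed

section \<open>The decomposition theorem\<close>

theorem theorem2p3:
  fixes M :: "'n::finite fock set"
  assumes "cfock.subspace M" and "closed M"
    and "\<And>i. left_creation i ` M \<subseteq> M"
  shows "(\<exists>(J :: nat set) \<phi>. represents J \<phi> M) \<and>
    (\<forall>(J :: nat set) \<phi> (K :: nat set) \<psi>.
      represents J \<phi> M \<and> represents K \<psi> M \<longrightarrow> essentially_equal J \<phi> K \<psi>)"
proof -
  have M: "left_invariant M"
    using assms by (simp add: left_invariant_def closed_csubspace_def)
  obtain J :: "nat set" and v where "orthonormal_on J v" "wandering M = closure (cfock.span (v ` J))"
    using orthonormal_basis_exists[OF closed_csubspace_wandering[OF M]] by blast
  then have "represents J (\<lambda>j. flip (v j)) M"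
    by (rule wandering_basis_represents[OF M])
  moreover have "essentially_equal J \<phi> K \<psi>"
    if J: "represents J \<phi> M" and K: "represents K \<psi> M" for J K :: "nat set" and \<phi> \<psi>
    using represents_imp_wandering_basis[OF M J] represents_imp_wandering_basis[OF M K]
    by (intro essentially_equal_if_same_closed_span) simp_all
  ultimately show ?thesis
    by blast
qed

end
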